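(* Let $\alpha=(\alpha_1<\alpha_2<\dots)$ be a strictly increasing (finite or infinite) sequence of positive integers with $\sum_k1/\alpha_k<\infty$, let $0<p\le 1$, and let $O$ be a random element of $\mathcal O$ distributed according to $P^{(\alpha,p)}$. Then $P^{(\alpha,p)}$-almost surely: (i) for every $k$, the $k$th non-record position in the permutation $\pi_n^\infty(O)$ converges to $\alpha_k+1$ as $n\to\infty$ (if $\alpha_k$ is not defined, this means that if for large $n$ the $k$th non-record position in $\pi_n^\infty(O)$ exists, then it converges to $+\infty$); (ii) $\displaystyle\liminf_{n\to\infty}\frac{(\pi_n^\infty(O))^{-1}(n)}{n}=p.$
   Context: Let $[n]=\{1,\dots,n\}$ and let $\mathfrak S_n$ be the set of permutations of $[n]$, written as words $\sigma(1)\dots\sigma(n)$. A position $j\in[n]$ is a record of $\sigma\in\mathfrak S_n$ if $\sigma(j)=\max_{i\le j}\sigma(i)$, and a non-record otherwise; the $k$th non-record position is the $k$th smallest one. $\mathcal O$ is the space of total orders on $\mathbb N=\{1,2,\dots\}$, viewed as the projective limit of the discrete spaces $\mathfrak S_n$ under the maps deleting the letter $n$ from a word; $\pi_n^\infty:\mathcal O\to\mathfrak S_n$ sends an order to the permutation word listing the elements of $[n]$ in increasing order with respect to that order. Thus $(\pi_n^\infty(O))^{-1}(n)$ is the position of letter $n$ in this word. Measures on $\mathcal O$: (a) $P^*$ is the unique Borel probability measure on $\mathcal O$ whose pushforward under $\pi_n^\infty$ is uniform on $\mathfrak S_n$ for every $n$. (b) $P^{(\alpha,1)}$: take independent $r_1,r_2,\dots$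 with $r_i= i$ if $i\notin\{\alpha_1+1,\alpha_2+1,\dots\}$ and $r_i$ uniform on $[i-1]$ if $i\in\{\alpha_1+1,\alpha_2+1,\dots\}$. Define $r_{i,i}=r_i$, $r_{i,j+1}=r_{i,j}+1(r_{j+1}\le r_{i,j})$ for $j\ge i$, and $\sigma(i)=\lim_{j\to\infty}r_{i,j}$. Almost surely $\sigma$ is a bijection $\mathbb N\to\mathbb N$; $P^{(\alpha,1)}$ is the law of the total order on $\mathbb N$ in which $i$ precedes $j$ iff $\sigma^{-1}(i)<\sigma^{-1}(j)$. (c) $P^{(\alpha,p)}$: assign each integer independently to $N_1$ with probability $p$ and to $N_2=\mathbb N\setminus N_1$ with probability $1-p$. Independently of this and of each other, order $N_1$ by a $P^{(\alpha,1)}$-distributed order and $N_2$ by a $P^*$-distributed order, transported via the increasing bijections with $\mathbb N$, and let every element of $N_1$ precede every element of $N_2$. (For $p=1$, $N_2=\emptyset$ and this is (b).) $P^{(\alpha,p)}$ is the law of the resulting order. *)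

theory Defs
  imports "HOL-Probability.Probability" "HOL-Combinatorics.Permutations"
begin

text \<open>
  The set of positive integers is \<open>{1..}\<close> in type \<^typ>\<open>nat\<close>. Orders are reflexive relations:
  \<open>(i, j) \<in> R\<close> means that \<open>i = j\<close> or \<open>i\<close> precedes \<open>j\<close>.
\<close>

definition orders :: "nat rel set" where
  "orders = {R. linear_order_on {1..} R}"

abbreviation perms :: "nat \<Rightarrow> (nat \<Rightarrow> nat) set" where
  "perms n \<equiv> {s. s permutes {1..n}}"

text \<open>
  The word \<open>s 1, ..., s n\<close> listing \<open>{1..n}\<close> in increasing order with respect to \<open>R\<close>
  (a permutation of \<open>{1..n}\<close> is extended by the identity).
\<close>

definition order_word :: "nat \<Rightarrow> nat rel \<Rightarrow> nat \<Rightarrow> nat" where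
  "order_word n R = (THE s. s permutes {1..n} \<and>
     (\<forall>i\<in>{1..n}. \<forall>j\<in>{1..n}. i < j \<longrightarrow> (s i, s j) \<in> R))"

text \<open>
  The projective limit topology is the coarsest topology making every \<^const>\<open>order_word\<close> map
  continuous into the discrete space of permutations.
\<close>

definition orders_topology :: "nat rel topology" where
  "orders_topology =
     topology_generated_by {{R \<in> orders. order_word n R = s} | n s. s permutes {1..n}}"

definition orders_borel :: "nat rel measure" where
  "orders_borel = sigma (topspace orders_topology) {U. openin orders_topology U}"

definition nonrecords :: "nat \<Rightarrow> (nat \<Rightarrow> nat) \<Rightarrow> nat set" where
  "nonrecords n s = {j \<in> {1..n}. s j \<noteq> Max (s ` {1..j})}"

text \<open>
  The \<open>k\<close>th (counting from 1) non-record position; meaningful only for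
  \<open>1 \<le> k \<le> card (nonrecords n s)\<close>.
\<close>

definition kth_nonrecord :: "nat \<Rightarrow> (nat \<Rightarrow> nat) \<Rightarrow> nat \<Rightarrow> nat" where
  "kth_nonrecord n s k = sorted_list_of_set (nonrecords n s) ! (k - 1)"

definition uniform_order :: "nat rel measure" where
  "uniform_order = (THE M. prob_space M \<and> sets M = sets orders_borel \<and>
     (\<forall>n. distr M (count_space (perms n)) (order_word n) = uniform_count_measure (perms n)))"

text \<open>
  A finite or infinite sequence is a function \<open>a\<close> on the index set below, where
  \<open>len\<close> is the length (\<open>\<infinity>\<close> for infinite sequences); other values of \<open>a\<close> are irrelevant.
\<close>

definition seq_indices :: "enat \<Rightarrow> nat set" where
  "seq_indices len = {k. 1 \<le> k \<and> enat k \<le> len}"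

definition relrank_law :: "enat \<Rightarrow> (nat \<Rightarrow> nat) \<Rightarrow> (nat \<Rightarrow> nat) measure" where
  "relrank_law len a = (\<Pi>\<^sub>M i\<in>{1..}.
     measure_pmf (if i \<in> (\<lambda>k. a k + 1) ` seq_indices len
                  then pmf_of_set {1..i - 1} else return_pmf i))"

text \<open>\<open>rank_upto r i j\<close> is \<open>r\<^bsub>i,j\<^esub>\<close>; only \<open>1 \<le> i \<le> j\<close> is meaningful.\<close>

fun rank_upto :: "(nat \<Rightarrow> nat) \<Rightarrow> nat \<Rightarrow> nat \<Rightarrow> nat" where
  "rank_upto r i 0 = r i"
| "rank_upto r i (Suc j) =
     (if j < i then r i
      else rank_upto r i j + (if r (Suc j) \<le> rank_upto r i j then 1 else 0))"

definition limit_rank :: "(nat \<Rightarrow> nat) \<Rightarrow> nat \<Rightarrow> nat" where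
  "limit_rank r i = lim (\<lambda>j. rank_upto r i j)"

text \<open>
  The usual order is used on the null event where the limit ranks do not exist or do not form a
  bijection, so that the value is a total order in every case.
\<close>

definition order_of_ranks :: "(nat \<Rightarrow> nat) \<Rightarrow> nat rel" where
  "order_of_ranks r =
     (if (\<forall>i\<ge>1. convergent (\<lambda>j. rank_upto r i j)) \<and> bij_betw (limit_rank r) {1..} {1..}
      then {(i, j). 1 \<le> i \<and> 1 \<le> j \<and>
              inv_into {1..} (limit_rank r) i \<le> inv_into {1..} (limit_rank r) j}
      else {(i, j). 1 \<le> i \<and> i \<le> j})"

definition nonrecord_order :: "enat \<Rightarrow> (nat \<Rightarrow> nat) \<Rightarrow> nat rel measure" where
  "nonrecord_order len a = distr (relrank_law len a) orders_borel order_of_ranks"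

text \<open>
  For infinite \<open>N\<close>, the map \<open>i \<mapsto> card (N \<inter> {1..i})\<close> is the increasing bijection from \<open>N\<close>
  to \<open>{1..}\<close>. For finite \<open>N\<close> (in particular \<open>N = {}\<close>) the same formula
  still gives a total order on \<open>N\<close>.
\<close>

definition transport_order :: "nat set \<Rightarrow> nat rel \<Rightarrow> nat rel" where
  "transport_order N R =
     {(i, j). i \<in> N \<and> j \<in> N \<and> (card (N \<inter> {1..i}), card (N \<inter> {1..j})) \<in> R}"

definition concat_order :: "nat set \<Rightarrow> nat rel \<Rightarrow> nat rel \<Rightarrow> nat rel" where
  "concat_order N1 R1 R2 =
     (let N2 = {1..} - N1
      in transport_order N1 R1 \<union> transport_order N2 R2 \<union> N1 \<times> N2)"

definition mixed_order :: "enat \<Rightarrow> (nat \<Rightarrow> nat) \<Rightarrow> real \<Rightarrow> nat rel measure" where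
  "mixed_order len a p =
     distr ((\<Pi>\<^sub>M i\<in>{1..}. measure_pmf (bernoulli_pmf p)) \<Otimes>\<^sub>M
            (nonrecord_order len a \<Otimes>\<^sub>M uniform_order))
       orders_borel
       (\<lambda>(b, R1, R2). concat_order {i \<in> {1..}. b i} R1 R2)"

end

theory Submission
  imports Defs "HOL-Real_Asymp.Real_Asymp"
begin

text \<open>
  Let \<open>S = {\<alpha>\<^sub>k + 1}\<close>. In the construction of \<open>P\<^bsup>(\<alpha>,1)\<^esup>\<close> the number
  \<open>D\<^sub>m\<close> of \<open>i \<in> S\<close> with \<open>r\<^sub>i \<le> m\<close> is a sum of independent
  indicators whose mean is at most \<open>C + \<epsilon> m\<close> for every \<open>\<epsilon> > 0\<close>, because
  \<open>\<Sum> 1 / \<alpha>\<^sub>k < \<infinity>\<close>; a Chernoff bound and Borel--Cantelli give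
  \<open>D\<^sub>m = o(m)\<close> almost surely. Everything else about \<open>\<sigma>\<close> is deterministic. If
  \<open>r\<^bsub>i,j\<^esub> = x\<close> then \<open>x \<le> r\<^sub>i + D\<^sub>x\<close>, so the ranks stay bounded and
  \<open>\<sigma>(i)\<close> exists; it is a bijection because \<open>r\<^sub>i\<close> eventually exceeds every given value.
  The first \<open>M\<close> letters of the \<open>n\<close>th word are \<open>\<sigma>(1), \<dots>, \<sigma>(M)\<close> for large \<open>n\<close>,
  which identifies the initial non-records as the elements of \<open>S\<close>, and at most
  \<open>D\<^sub>n\<close> letters follow the letter \<open>n\<close>.

  For general \<open>p\<close> the letters of \<open>N\<^sub>1\<close> form the initial segment of length
  \<open>A\<^sub>n = |N\<^sub>1 \<inter> [n]| \<sim> p n\<close> of the \<open>n\<close>th word. Non-records in that segment are those of the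
  order on \<open>N\<^sub>1\<close>; the letter \<open>n\<close> is at position
  \<open>A\<^sub>n - o(n)\<close> if \<open>n \<in> N\<^sub>1\<close> and beyond \<open>A\<^sub>n\<close> otherwise, so the
  lower limit is \<open>p\<close> whatever the order on \<open>N\<^sub>2\<close>.
\<close>

section \<open>Almost sure statements and counts of independent events\<close>

text \<open>On every set \<open>measure_of\<close> yields either the value of \<open>\<mu>\<close>
  or 0, so null values survive even where countable additivity of \<open>\<mu>\<close> is
  unknown.\<close>

lemma emeasure_measure_of_eq_0:
  assumes "\<mu> A = 0"
  shows "emeasure (measure_of \<Omega> S \<mu>) A = 0"
  by (simp add: emeasure_measure_of_conv assms)

text \<open>
  If \<open>f\<close> is not measurable and the image of \<open>M\<close> fails to be countably additive, then
  \<^const>\<open>distr\<close> is by convention the zero measure.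
\<close>

lemma AE_distrI:
  assumes P: "{y \<in> space N. P y} \<in> sets N"
    and AE: "AE x in M. f x \<in> space N \<longrightarrow> P (f x)"
  shows "AE y in distr M N f. P y"
proof -
  have eq: "space N - {y \<in> space N. P y} = {y \<in> space N. \<not> P y}"
    by auto
  have meas: "{y \<in> space N. \<not> P y} \<in> sets N"
    using sets.compl_sets[OF P] by (simp add: eq)
  have "emeasure M {x \<in> space M. f x \<in> space N \<and> \<not> P (f x)} = 0"
    by (rule emeasure_eq_0_AE) (use AE in auto)
  moreover have "f -` {y \<in> space N. \<not> P y} \<inter> space M = {x \<in> space M. f x \<in> space N \<and> \<not> P (f x)}"
    by auto
  ultimately have "emeasure (distr M N f) {y \<in> space N. \<not> P y} = 0"
    unfolding distr_def by (intro emeasure_measure_of_eq_0) simp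
  then have "{y \<in> space N. \<not> P y} \<in> null_sets (distr M N f)"
    using meas by (intro null_setsI) auto
  then show ?thesis
    by (rule AE_I') auto
qed

text \<open>
  The factors need not be \<open>\<sigma>\<close>-finite: a product that fails to be countably additive is
  by convention the zero measure.
\<close>

lemma AE_pair_fst:
  assumes "AE x in A. P x"
  shows "AE z in A \<Otimes>\<^sub>M B. P (fst z)"
proof -
  obtain N where N: "N \<in> null_sets A" "{x \<in> space A. \<not> P x} \<subseteq> N"
    using assms by (auto simp: eventually_ae_filter)
  have "AE x in A. x \<notin> N"
    using N(1) by (rule AE_not_in)
  then have "(\<integral>\<^sup>+x. (\<integral>\<^sup>+y. indicator (N \<times> space B) (x, y) \<partial>B) \<partial>A) = (\<integral>\<^sup>+x. 0 \<partial>A)"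
    by (intro nn_integral_cong_AE) (auto elim!: eventually_mono)
  then have "emeasure (A \<Otimes>\<^sub>M B) (N \<times> space B) = 0"
    unfolding pair_measure_def by (intro emeasure_measure_of_eq_0) simp
  then have "N \<times> space B \<in> null_sets (A \<Otimes>\<^sub>M B)"
    using N(1) by (intro null_setsI) auto
  then show ?thesis
    by (rule AE_I') (use N(2) in \<open>auto simp: space_pair_measure\<close>)
qed

lemma AE_pair_snd:
  assumes "AE y in B. P y"
  shows "AE z in A \<Otimes>\<^sub>M B. P (snd z)"
proof -
  obtain N where N: "N \<in> null_sets B" "{x \<in> space B. \<not> P x} \<subseteq> N"
    using assms by (auto simp: eventually_ae_filter)
  have "AE y in B. y \<notin> N"
    using N(1) by (rule AE_not_in)
  then have "(\<integral>\<^sup>+y. indicator (space A \<times> N) (x, y) \<partial>B) = (\<integral>\<^sup>+y. 0 \<partial>B)" for x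
    by (intro nn_integral_cong_AE) (auto elim!: eventually_mono)
  then have "emeasure (A \<Otimes>\<^sub>M B) (space A \<times> N) = 0"
    unfolding pair_measure_def by (intro emeasure_measure_of_eq_0) simp
  then have "space A \<times> N \<in> null_sets (A \<Otimes>\<^sub>M B)"
    using N(1) by (intro null_setsI) auto
  then show ?thesis
    by (rule AE_I') (use N(2) in \<open>auto simp: space_pair_measure\<close>)
qed

text \<open>Independence means that the joint law is the product of the marginal laws; for the
  coordinates both are \<open>PiM I M\<close> itself.\<close>

lemma indep_vars_PiM_component:
  assumes M: "\<And>i. i \<in> I \<Longrightarrow> prob_space (M i)" and "I \<noteq> {}"
  shows "prob_space.indep_vars (PiM I M) M (\<lambda>i \<omega>. \<omega> i) I"
proof -
  interpret prob_space "PiM I M"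
    by (rule prob_space_PiM) fact
  have "distr (PiM I M) (PiM I M) (\<lambda>\<omega>. restrict \<omega> I) = PiM I M"
    by (subst distr_cong[OF refl refl, where g = "\<lambda>\<omega>. \<omega>"])
       (auto simp: space_PiM distr_id intro: PiE_restrict)
  moreover have "(\<Pi>\<^sub>M i\<in>I. distr (PiM I M) (M i) (\<lambda>\<omega>. \<omega> i)) = PiM I M"
    by (intro PiM_cong distr_PiM_component refl M)
  ultimately show ?thesis
    using \<open>I \<noteq> {}\<close> by (subst indep_vars_iff_distr_eq_PiM') auto
qed

text \<open>Chernoff bound with exponential parameter 1: an indicator of probability x has
  exponential moment 1 + (e - 1) x, at most 1 + 2 x and hence at most exp (2 x). Independence
  multiplies these factors.\<close>

lemma (in prob_space) prob_card_ge_le: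
  fixes X :: "'i \<Rightarrow> 'a \<Rightarrow> bool"
  assumes I: "finite I" and X: "indep_vars (\<lambda>_. count_space UNIV) X I"
  shows "prob {\<omega> \<in> space M. t \<le> real (card {i \<in> I. X i \<omega>})} \<le>
           exp (2 * (\<Sum>i\<in>I. prob {\<omega> \<in> space M. X i \<omega>}) - t)"
proof -
  let ?p = "\<lambda>i. prob {\<omega> \<in> space M. X i \<omega>}"
  let ?e = "\<lambda>i \<omega>. ennreal (if X i \<omega> then exp 1 else 1)"
  have meas[measurable]: "X i \<in> measurable M (count_space UNIV)" if "i \<in> I" for i
    using X that by (auto simp: indep_vars_def)
  have card_eq: "real (card {i \<in> I. X i \<omega>}) = (\<Sum>i\<in>I. of_bool (X i \<omega>))" for \<omega>
    using I by (simp add: Int_def)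
  have exp_card: "ennreal (exp (real (card {i \<in> I. X i \<omega>}))) = (\<Prod>i\<in>I. ?e i \<omega>)" for \<omega>
    unfolding card_eq exp_sum[OF I] using I
    by (subst prod_ennreal) (auto intro!: arg_cong[where f = ennreal] prod.cong)
  have e1: "(\<integral>\<^sup>+\<omega>. ?e i \<omega> \<partial>M) \<le> ennreal (exp (2 * ?p i))" if i: "i \<in> I" for i
  proof -
    note [measurable] = meas[OF i]
    have e: "ennreal (exp 1) = 1 + ennreal (exp 1 - 1)"
      using ennreal_plus[of 1 "exp 1 - 1"] by simp
    have "(\<integral>\<^sup>+\<omega>. ?e i \<omega> \<partial>M) =
        (\<integral>\<^sup>+\<omega>. 1 + ennreal (exp 1 - 1) * indicator {\<omega> \<in> space M. X i \<omega>} \<omega> \<partial>M)"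
      by (intro nn_integral_cong) (auto simp: e)
    also have "\<dots> = 1 + ennreal (exp 1 - 1) * emeasure M {\<omega> \<in> space M. X i \<omega>}"
      by (subst nn_integral_add) (auto simp: nn_integral_cmult_indicator emeasure_space_1)
    also have "\<dots> = ennreal (1 + (exp 1 - 1) * ?p i)"
      by (subst ennreal_plus) (auto simp: emeasure_eq_measure ennreal_mult)
    \<comment> \<open>\<open>exp_le\<close> states e \<le> 3, which is the origin of the factor
      2.\<close>
    also have "\<dots> \<le> ennreal (1 + 2 * ?p i)"
      using exp_le by (intro ennreal_leI add_left_mono mult_right_mono) auto
    also have "\<dots> \<le> ennreal (exp (2 * ?p i))"
      by (intro ennreal_leI exp_ge_add_one_self)
    finally show ?thesis .
  qed
  have "emeasure M {\<omega> \<in> space M. t \<le> real (card {i \<in> I. X i \<omega>})} \<le>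
      ennreal (exp (- 1 * t)) *
      (\<integral>\<^sup>+\<omega>. ennreal (exp (1 * real (card {i \<in> I. X i \<omega>}))) * indicator (space M) \<omega> \<partial>M)"
    unfolding card_eq by (intro Chernoff_ineq_nn_integral_ge) auto
  also have "(\<integral>\<^sup>+\<omega>. ennreal (exp (1 * real (card {i \<in> I. X i \<omega>}))) * indicator (space M) \<omega> \<partial>M) =
      (\<integral>\<^sup>+\<omega>. (\<Prod>i\<in>I. ?e i \<omega>) \<partial>M)"
    by (intro nn_integral_cong) (simp add: exp_card)
  also have "\<dots> = (\<Prod>i\<in>I. \<integral>\<^sup>+\<omega>. ?e i \<omega> \<partial>M)"
    by (intro indep_vars_nn_integral I indep_vars_compose2[OF X]) auto
  also have "\<dots> \<le> (\<Prod>i\<in>I. ennreal (exp (2 * ?p i)))"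
    by (intro prod_mono_ennreal e1)
  also have "\<dots> = ennreal (exp (2 * (\<Sum>i\<in>I. ?p i)))"
    using I by (simp add: prod_ennreal exp_sum sum_distrib_left)
  finally have "emeasure M {\<omega> \<in> space M. t \<le> real (card {i \<in> I. X i \<omega>})} \<le>
      ennreal (exp (- 1 * t)) * ennreal (exp (2 * (\<Sum>i\<in>I. ?p i)))"
    by (simp add: mult_left_mono)
  then show ?thesis
    by (simp add: emeasure_eq_measure flip: ennreal_mult exp_add)
       (simp add: algebra_simps)?
qed

text \<open>\<open>F\<close> is chosen with its sum within \<epsilon> of the total. By
  nonnegativity, adding a disjoint \<open>K\<close> cannot exceed the total, so \<open>K\<close>
  contributes at most \<epsilon>.\<close>

lemma summable_on_small_tails:
  fixes f :: "'i \<Rightarrow> real"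
  assumes f: "f summable_on S" and nonneg: "\<And>i. i \<in> S \<Longrightarrow> 0 \<le> f i" and "0 < \<epsilon>"
  obtains F where "finite F" "F \<subseteq> S" "\<And>K. finite K \<Longrightarrow> K \<subseteq> S - F \<Longrightarrow> sum f K \<le> \<epsilon>"
proof -
  have "\<forall>\<^sub>F F in finite_subsets_at_top S. dist (sum f F) (infsum f S) < \<epsilon>"
    using infsum_tendsto[OF f] \<open>0 < \<epsilon>\<close> by (rule tendstoD)
  then obtain F where F: "finite F" "F \<subseteq> S" "dist (sum f F) (infsum f S) < \<epsilon>"
    by (auto simp: eventually_finite_subsets_at_top)
  have "sum f K \<le> \<epsilon>" if K: "finite K" "K \<subseteq> S - F" for K
  proof -
    have "sum f (F \<union> K) \<le> infsum f S"
      using F K nonneg by (intro finite_sum_le_infsum f) auto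
    moreover have "sum f (F \<union> K) = sum f F + sum f K"
      using F K by (intro sum.union_disjoint) auto
    ultimately show ?thesis
      using F(3) by (simp add: dist_real_def)
  qed
  with F that show thesis
    by blast
qed

text \<open>\<open>prob_card_ge_le\<close> on the finite truncations \<open>K n\<close> gives a
  bound geometric in \<open>m\<close> and uniform in \<open>n\<close>. Continuity from below carries
  it to the union over \<open>n\<close>, and Borel-Cantelli over \<open>m\<close> finishes.\<close>

lemma (in prob_space) AE_card_le_sublinear:
  fixes r :: "nat \<Rightarrow> 'a \<Rightarrow> nat" and f :: "nat \<Rightarrow> real"
  assumes r: "indep_vars (\<lambda>_. count_space UNIV) r S"
    and f: "f summable_on S" and f0: "\<And>i. i \<in> S \<Longrightarrow> 0 \<le> f i"
    and prob: "\<And>i m. i \<in> S \<Longrightarrow> prob {\<omega> \<in> space M. r i \<omega> \<le> m} \<le> real m * f i"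
  shows "AE \<omega> in M. \<forall>q. \<forall>\<^sub>F m in sequentially.
    finite {i \<in> S. r i \<omega> \<le> m} \<and> real (Suc q) * card {i \<in> S. r i \<omega> \<le> m} \<le> real m"
proof (subst AE_all_countable, rule allI)
  fix q :: nat
  \<comment> \<open>Dropping a finite set \<open>F\<close> costs only a constant and makes the mean number of remaining
    \<open>i\<close> with \<open>r i \<omega> \<le> m\<close> smaller than \<open>\<epsilon> m / 4\<close>.\<close>
  define \<epsilon> where "\<epsilon> = 1 / (2 * real (Suc q))"
  have "0 < \<epsilon>"
    by (simp add: \<epsilon>_def)
  obtain F where F: "finite F" "F \<subseteq> S" "\<And>K. finite K \<Longrightarrow> K \<subseteq> S - F \<Longrightarrow> sum f K \<le> \<epsilon> / 4"
    using summable_on_small_tails[OF f f0, of "\<epsilon> / 4"] \<open>0 < \<epsilon>\<close> by auto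
  define K where "K n = (S - F) \<inter> {..n}" for n
  define B where "B m n = {\<omega> \<in> space M. \<epsilon> * real m \<le> card {i \<in> K n. r i \<omega> \<le> m}}" for m n
  have K: "finite (K n)" "K n \<subseteq> S" for n
    by (auto simp: K_def)
  have [measurable]: "r i \<in> measurable M (count_space UNIV)" if "i \<in> K n" for i n
    using r that K(2) by (auto simp: indep_vars_def)
  have card_eq: "real (card {i \<in> K n. r i \<omega> \<le> m}) = (\<Sum>i\<in>K n. of_bool (r i \<omega> \<le> m))" for m n \<omega>
    using K(1) by (simp add: Int_def)
  have meas[measurable]: "B m n \<in> sets M" for m n
    unfolding B_def card_eq by measurable
  have B_bound: "prob (B m n) \<le> exp (- \<epsilon> / 2) ^ m" for m n
  proof -
    have ind: "indep_vars (\<lambda>_. count_space UNIV) (\<lambda>i \<omega>. r i \<omega> \<le> m) (K n)"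
      by (rule indep_vars_compose2[OF indep_vars_subset[OF r K(2)]]) auto
    have "prob (B m n) \<le> exp (2 * (\<Sum>i\<in>K n. prob {\<omega> \<in> space M. r i \<omega> \<le> m}) - \<epsilon> * real m)"
      unfolding B_def by (rule prob_card_ge_le[OF K(1) ind])
    \<comment> \<open>The mean is at most \<epsilon> m / 4, so the exponent is at most 2 (\<epsilon>
      m / 4) - \<epsilon> m = - \<epsilon> m / 2.\<close>
    also have "\<dots> \<le> exp (- \<epsilon> / 2 * real m)"
    proof -
      have "(\<Sum>i\<in>K n. prob {\<omega> \<in> space M. r i \<omega> \<le> m}) \<le> (\<Sum>i\<in>K n. real m * f i)"
        using K(2) by (intro sum_mono prob) auto
      also have "\<dots> = real m * sum f (K n)"
        by (simp add: sum_distrib_left)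
      also have "\<dots> \<le> real m * (\<epsilon> / 4)"
        by (intro mult_left_mono F(3) K) (auto simp: K_def)
      finally show ?thesis
        by (simp add: algebra_simps)
    qed
    finally show ?thesis
      using exp_of_nat_mult[of m "- \<epsilon> / 2"] by (simp add: mult.commute)
  qed
  have "incseq (B m)" for m
  proof (rule incseq_SucI, rule subsetI)
    fix n \<omega>
    assume "\<omega> \<in> B m n"
    moreover have "card {i \<in> K n. r i \<omega> \<le> m} \<le> card {i \<in> K (Suc n). r i \<omega> \<le> m}"
      by (rule card_mono) (auto simp: K_def)
    ultimately show "\<omega> \<in> B m (Suc n)"
      by (auto simp: B_def intro: order.trans)
  qed
  then have lim: "(\<lambda>n. prob (B m n)) \<longlonglongrightarrow> prob (\<Union>n. B m n)" for m
    using meas by (intro finite_Lim_measure_incseq) auto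
  have bound: "prob (\<Union>n. B m n) \<le> exp (- \<epsilon> / 2) ^ m" for m
    by (rule LIMSEQ_le_const2[OF lim]) (use B_bound in auto)
  have "summable (\<lambda>m. prob (\<Union>n. B m n))"
    by (rule summable_comparison_test'[OF summable_geometric[of "exp (- \<epsilon> / 2)"]])
       (use \<open>0 < \<epsilon>\<close> bound in auto)
  then have "AE \<omega> in M. \<forall>\<^sub>F m in sequentially. \<omega> \<in> space M - (\<Union>n. B m n)"
    by (intro borel_cantelli_AE1) (auto simp: emeasure_eq_measure)
  then show "AE \<omega> in M. \<forall>\<^sub>F m in sequentially.
    finite {i \<in> S. r i \<omega> \<le> m} \<and> real (Suc q) * card {i \<in> S. r i \<omega> \<le> m} \<le> real m"
  proof eventually_elim
    fix \<omega>
    assume ev: "\<forall>\<^sub>F m in sequentially. \<omega> \<in> space M - (\<Union>n. B m n)"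
    \<comment> \<open>The allowance m / (q + 1) equals 2 \<epsilon> m: one half pays for
      \<open>F\<close>, the other for the rest of \<open>S\<close>.\<close>
    have "\<forall>\<^sub>F m in sequentially. real (card F) \<le> \<epsilon> * real m"
      using \<open>0 < \<epsilon>\<close> by real_asymp
    with ev show "\<forall>\<^sub>F m in sequentially.
      finite {i \<in> S. r i \<omega> \<le> m} \<and> real (Suc q) * card {i \<in> S. r i \<omega> \<le> m} \<le> real m"
    proof eventually_elim
      fix m
      assume nB: "\<omega> \<in> space M - (\<Union>n. B m n)" and card_F: "real (card F) \<le> \<epsilon> * real m"
      let ?D = "{i \<in> S - F. r i \<omega> \<le> m}"
      \<comment> \<open>Each finite part of \<open>?D\<close> lies in some \<open>K n\<close>, and
        avoiding \<open>B m n\<close> bounds its size. An infinite \<open>?D\<close> would have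
        finite subsets of any size, so this bound also forces finiteness.\<close>
      have sub: "real (card T) \<le> \<epsilon> * real m" if "finite T" "T \<subseteq> ?D" for T
      proof -
        obtain n where "T \<subseteq> {..n}"
          using \<open>finite T\<close> finite_nat_iff_bounded_le by blast
        then have "card T \<le> card {i \<in> K n. r i \<omega> \<le> m}"
          using that by (intro card_mono) (auto simp: K_def)
        with nB show ?thesis
          by (auto simp: B_def not_le dest!: spec[of _ n] intro: order.trans[OF of_nat_mono less_imp_le])
      qed
      have fin: "finite ?D"
      proof (rule ccontr)
        assume "infinite ?D"
        then obtain T where "finite T" "card T = Suc (nat \<lceil>\<epsilon> * real m\<rceil>)" "T \<subseteq> ?D"
          by (meson infinite_arbitrarily_large)
        with sub[of T] show False
          by linarith
      qed
      have le: "{i \<in> S. r i \<omega> \<le> m} \<subseteq> F \<union> ?D"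
        by auto
      have "real (card {i \<in> S. r i \<omega> \<le> m}) \<le> real (card (F \<union> ?D))"
        using fin F(1) by (intro of_nat_mono card_mono le) auto
      also have "\<dots> \<le> real (card F) + real (card ?D)"
        using card_Un_le[of F ?D] by linarith
      also have "\<dots> \<le> 2 * \<epsilon> * real m"
        using sub[OF fin order.refl] card_F by linarith
      finally have "real (Suc q) * card {i \<in> S. r i \<omega> \<le> m} \<le> real (Suc q) * (2 * \<epsilon> * real m)"
        by (intro mult_left_mono) auto
      also have "\<dots> = real m"
        by (simp add: \<epsilon>_def del: of_nat_Suc)
      finally show "finite {i \<in> S. r i \<omega> \<le> m} \<and>
          real (Suc q) * card {i \<in> S. r i \<omega> \<le> m} \<le> real m"
        using finite_subset[OF le] fin F(1) by auto
    qed
  qed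
qed

text \<open>Strong law through Hoeffding's inequality: a deviation of at least 1 / (q + 1) from the
  mean frequency has probability exponentially small in \<open>n\<close>, so Borel-Cantelli applies
  for every \<open>q\<close>.\<close>

lemma bernoulli_frequency:
  assumes p: "0 \<le> p" "p \<le> 1"
  shows "AE b in (\<Pi>\<^sub>M i\<in>{1::nat..}. measure_pmf (bernoulli_pmf p)).
    (\<lambda>n. card {i \<in> {1..n}. b i} / real n) \<longlonglongrightarrow> p"
proof -
  let ?M = "\<Pi>\<^sub>M i\<in>{1::nat..}. measure_pmf (bernoulli_pmf p)"
  interpret prob_space ?M
    by (intro prob_space_PiM measure_pmf.prob_space_axioms)
  define X where "X i b = (of_bool (b i) :: real)" for i :: nat and b :: "nat \<Rightarrow> bool"
  have ind: "indep_vars (\<lambda>_. borel) X {1..}"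
    unfolding X_def
    by (rule indep_vars_compose2[OF indep_vars_PiM_component])
       (auto intro: measure_pmf.prob_space_axioms)
  have E: "expectation (X i) = p" if "i \<ge> 1" for i
  proof -
    have "expectation (X i) = (\<integral>x. of_bool x \<partial>distr ?M (measure_pmf (bernoulli_pmf p)) (\<lambda>b. b i))"
      unfolding X_def using that by (subst integral_distr) auto
    also have "distr ?M (measure_pmf (bernoulli_pmf p)) (\<lambda>b. b i) = measure_pmf (bernoulli_pmf p)"
      using that by (intro distr_PiM_component measure_pmf.prob_space_axioms) auto
    finally show ?thesis
      using p by simp
  qed
  have X_meas[measurable]: "X i \<in> borel_measurable ?M" if "i \<ge> 1" for i
    using ind that unfolding indep_vars_def by auto
  define B where "B q n = {b \<in> space ?M. \<bar>(\<Sum>i\<in>{1..n}. X i b) - real n * p\<bar> \<ge> real n / real (Suc q)}"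
    for q n
  have B_meas: "B q n \<in> sets ?M" for q n
    unfolding B_def by measurable
  have bound: "prob (B q n) \<le> 2 * exp (- 2 / (real (Suc q))\<^sup>2) ^ n" if "n > 0" for q n
  proof -
    have sum_E: "(\<Sum>i\<in>{1..n}. expectation (X i)) = real n * p"
      using E by (subst sum.cong[OF refl, where h = "\<lambda>_. p"]) auto
    have ind_n: "indep_vars (\<lambda>_. borel) X {1..n}"
      by (rule indep_vars_subset[OF ind]) auto
    interpret Hoeffding_ineq ?M "{1..n}" X "\<lambda>_. 0" "\<lambda>_. 1" "\<Sum>i\<in>{1..n}. expectation (X i)"
      by unfold_locales (use ind_n in \<open>simp_all add: X_def\<close>)
    have "prob (B q n) \<le> 2 * exp (- 2 * (real n / real (Suc q))\<^sup>2 / n)"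
      using Hoeffding_ineq_abs_ge[of "real n / real (Suc q)"] that unfolding B_def sum_E by simp
    also have "- 2 * (real n / real (Suc q))\<^sup>2 / n = real n * (- 2 / (real (Suc q))\<^sup>2)"
      using that by (simp add: power2_eq_square)
    finally show ?thesis
      by (simp only: exp_of_nat_mult)
  qed
  have "AE b in ?M. \<forall>q. \<forall>\<^sub>F n in sequentially. b \<in> space ?M - B q n"
  proof (subst AE_all_countable, rule allI)
    fix q :: nat
    have "summable (\<lambda>n. prob (B q n))"
    \<comment> \<open>The comparison starts at 1 because \<open>bound\<close> is available for
      positive \<open>n\<close> only.\<close>
    proof (rule summable_comparison_test'[of _ 1])
      show "summable (\<lambda>n. 2 * exp (- 2 / (real (Suc q))\<^sup>2) ^ n)"
        by (intro summable_mult summable_geometric) simp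
    qed (use bound in auto)
    then show "AE b in ?M. \<forall>\<^sub>F n in sequentially. b \<in> space ?M - B q n"
      by (intro borel_cantelli_AE1 B_meas) (simp_all only: emeasure_eq_measure ennreal_less_top infinity_ennreal_def)
  qed
  then show ?thesis
  proof eventually_elim
    fix b
    assume b: "\<forall>q. \<forall>\<^sub>F n in sequentially. b \<in> space ?M - B q n"
    show "(\<lambda>n. card {i \<in> {1..n}. b i} / real n) \<longlonglongrightarrow> p"
    proof (rule tendstoI)
      fix e :: real
      assume "e > 0"
      then obtain q where q: "1 / real (Suc q) < e"
        using reals_Archimedean by (auto simp: inverse_eq_divide)
      show "\<forall>\<^sub>F n in sequentially. dist (card {i \<in> {1..n}. b i} / real n) p < e"
        using b[rule_format, of q] eventually_gt_at_top[of 0]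
      proof eventually_elim
        fix n :: nat
        assume n: "b \<in> space ?M - B q n" "n > 0"
        have card_eq: "(\<Sum>i\<in>{1..n}. X i b) = card {i \<in> {1..n}. b i}"
          by (simp add: X_def Int_def)
        have "\<bar>card {i \<in> {1..n}. b i} - real n * p\<bar> < real n / real (Suc q)"
          using n(1) unfolding B_def Diff_iff mem_Collect_eq card_eq by linarith
        also have "\<dots> < real n * e"
          using mult_strict_left_mono[OF q, of "real n"] n(2) by simp
        finally have "\<bar>card {i \<in> {1..n}. b i} - real n * p\<bar> / real n < e"
          using n(2) by (simp add: pos_divide_less_eq mult.commute)
        moreover have "card {i \<in> {1..n}. b i} / real n - p = (card {i \<in> {1..n}. b i} - real n * p) / real n"
          using n(2) by (simp add: diff_divide_distrib)
        ultimately show "dist (card {i \<in> {1..n}. b i} / real n) p < e"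
          by (simp add: dist_real_def abs_divide)
      qed
    qed
  qed
qed

section \<open>Words of orders\<close>

text \<open>
  For \<open>x \<in> {1..n}\<close> this is the position of the letter \<open>x\<close> in the word \<^term>\<open>order_word n R\<close>.
\<close>

definition rank_in :: "nat \<Rightarrow> nat rel \<Rightarrow> nat \<Rightarrow> nat" where
  "rank_in n R x = card {i \<in> {1..n}. (i, x) \<in> R}"

lemma orders_iff:
  "R \<in> orders \<longleftrightarrow> R \<subseteq> {1..} \<times> {1..} \<and> (\<forall>x\<ge>1. (x, x) \<in> R) \<and> trans R \<and> antisym R \<and>
     (\<forall>x\<ge>1. \<forall>y\<ge>1. (x, y) \<in> R \<or> (y, x) \<in> R)"
  unfolding orders_def order_on_defs refl_on_def total_on_def by (auto; metis atLeast_iff One_nat_def)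

context
  fixes R :: "nat rel"
  assumes R: "R \<in> orders"
begin

lemma rank_in_le_iff:
  assumes x: "x \<in> {1..n}" and y: "y \<in> {1..n}"
  shows "rank_in n R x \<le> rank_in n R y \<longleftrightarrow> (x, y) \<in> R"
proof
  assume "(x, y) \<in> R"
  then show "rank_in n R x \<le> rank_in n R y"
    unfolding rank_in_def using R by (intro card_mono) (auto simp: orders_iff elim: transE)
next
  assume le: "rank_in n R x \<le> rank_in n R y"
  show "(x, y) \<in> R"
  proof (rule ccontr)
    assume nR: "(x, y) \<notin> R"
    with R x y have "(y, x) \<in> R" "(x, x) \<in> R"
      by (auto simp: orders_iff)
    then have "{i \<in> {1..n}. (i, y) \<in> R} \<subset> {i \<in> {1..n}. (i, x) \<in> R}"
      using R x nR by (auto simp: orders_iff elim: transE)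
    then have "rank_in n R y < rank_in n R x"
      unfolding rank_in_def by (intro psubset_card_mono) auto
    with le show False
      by simp
  qed
qed

lemma rank_in_bounds: "rank_in n R x \<le> n" "x \<in> {1..n} \<Longrightarrow> 1 \<le> rank_in n R x"
proof -
  show "rank_in n R x \<le> n"
    unfolding rank_in_def by (rule order.trans[OF card_mono[of "{1..n}"]]) auto
  show "1 \<le> rank_in n R x" if "x \<in> {1..n}"
    using that R card_gt_0_iff[of "{i \<in> {1..n}. (i, x) \<in> R}"]
    by (auto simp: rank_in_def orders_iff Suc_le_eq)
qed

lemma bij_betw_rank_in: "bij_betw (rank_in n R) {1..n} {1..n}"
proof -
  have inj: "inj_on (rank_in n R) {1..n}"
  proof (rule inj_onI)
    fix x y
    assume xy: "x \<in> {1..n}" "y \<in> {1..n}" "rank_in n R x = rank_in n R y"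
    then have "(x, y) \<in> R" "(y, x) \<in> R"
      by (simp_all flip: rank_in_le_iff[where n = n])
    with R show "x = y"
      by (auto simp: orders_iff antisym_def)
  qed
  moreover have "rank_in n R ` {1..n} \<subseteq> {1..n}"
    using rank_in_bounds by fastforce
  ultimately have "rank_in n R ` {1..n} = {1..n}"
    by (intro endo_inj_surj) auto
  with inj show ?thesis
    by (simp add: bij_betw_def)
qed

text \<open>Shows that any sorted word inverts \<open>rank_in\<close>; this yields the uniqueness
  behind the \<open>THE\<close> in \<open>order_word\<close>.\<close>

lemma rank_in_sorted_word:
  assumes s: "s permutes {1..n}" and inc: "\<forall>i\<in>{1..n}. \<forall>j\<in>{1..n}. i < j \<longrightarrow> (s i, s j) \<in> R"
    and j: "j \<in> {1..n}"
  shows "rank_in n R (s j) = j"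
proof -
  have iff: "(s i, s j) \<in> R \<longleftrightarrow> i \<le> j" if i: "i \<in> {1..n}" for i
  proof
    assume ij: "(s i, s j) \<in> R"
    show "i \<le> j"
    proof (rule ccontr)
      assume "\<not> i \<le> j"
      then have "(s j, s i) \<in> R"
        using inc i j by auto
      with ij R have "s i = s j"
        by (auto simp: orders_iff antisym_def)
      with \<open>\<not> i \<le> j\<close> show False
        using permutes_inj[OF s] by (auto simp: inj_eq)
    qed
  next
    assume "i \<le> j"
    moreover have "s i \<in> {1..n}"
      using i permutes_in_image[OF s] by blast
    ultimately show "(s i, s j) \<in> R"
      using inc i j R by (cases "i = j") (auto simp: orders_iff)
  qed
  have "{x \<in> {1..n}. (x, s j) \<in> R} = s ` {1..j}"
  proof (rule set_eqI)
    fix x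
    have "x \<in> {1..n} \<longleftrightarrow> inv s x \<in> {1..n}"
      using permutes_in_image[OF permutes_inv[OF s]] by blast
    moreover have "x = s (inv s x)"
      using permutes_inverses[OF s] by simp
    moreover have "x \<in> s ` {1..j} \<longleftrightarrow> inv s x \<in> {1..j}"
      using permutes_inverses[OF s] by (metis image_iff)
    ultimately show "x \<in> {x \<in> {1..n}. (x, s j) \<in> R} \<longleftrightarrow> x \<in> s ` {1..j}"
      using iff[of "inv s x"] j by auto
  qed
  then show ?thesis
    unfolding rank_in_def
    by (simp add: card_image inj_on_subset[OF permutes_inj[OF s]])
qed

text \<open>Existence in the definite description: the inverse of the bijection
  \<open>rank_in n R\<close>, extended by the identity, is a sorted word.\<close>

lemma order_word_props:
  "order_word n R permutes {1..n}"
  "i \<in> {1..n} \<Longrightarrow> rank_in n R (order_word n R i) = i"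
proof -
  let ?P = "\<lambda>s. s permutes {1..n} \<and> (\<forall>i\<in>{1..n}. \<forall>j\<in>{1..n}. i < j \<longrightarrow> (s i, s j) \<in> R)"
  define s where "s i = (if i \<in> {1..n} then inv_into {1..n} (rank_in n R) i else i)" for i
  have bij: "bij_betw (inv_into {1..n} (rank_in n R)) {1..n} {1..n}"
    by (rule bij_betw_inv_into[OF bij_betw_rank_in])
  have s_in: "s i \<in> {1..n}" "rank_in n R (s i) = i" if "i \<in> {1..n}" for i
    using that bij_betwE[OF bij] bij_betw_inv_into_right[OF bij_betw_rank_in] by (auto simp: s_def)
  have "bij_betw s {1..n} {1..n}"
    using bij by (subst bij_betw_cong[where g = "inv_into {1..n} (rank_in n R)"]) (auto simp: s_def)
  then have "s permutes {1..n}"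
    by (intro bij_imp_permutes) (auto simp: s_def)
  then have P: "?P s"
    using s_in by (auto simp flip: rank_in_le_iff[of _ n])
  have "t = s" if t: "?P t" for t
  proof
    fix i
    show "t i = s i"
    proof (cases "i \<in> {1..n}")
      case True
      then have "rank_in n R (t i) = rank_in n R (s i)"
        using t s_in rank_in_sorted_word by metis
      moreover have "t i \<in> {1..n}"
        using t True permutes_in_image by metis
      ultimately show ?thesis
        using s_in(1)[OF True] bij_betw_rank_in[of n] by (auto simp: bij_betw_def dest: inj_onD)
    next
      case False
      with t P show ?thesis
        by (metis permutes_not_in)
    qed
  qed
  then have eq: "order_word n R = s"
    unfolding order_word_def by (intro the_equality P) auto
  show "order_word n R permutes {1..n}"
    "i \<in> {1..n} \<Longrightarrow> rank_in n R (order_word n R i) = i"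
    using P s_in(2) by (auto simp: eq)
qed

lemma order_word_in: "i \<in> {1..n} \<Longrightarrow> order_word n R i \<in> {1..n}"
  using permutes_in_image[OF order_word_props(1)] by blast

lemma inv_order_word:
  assumes "x \<in> {1..n}"
  shows "inv (order_word n R) x = rank_in n R x"
proof -
  have "inv (order_word n R) x \<in> {1..n}"
    using assms permutes_in_image[OF permutes_inv[OF order_word_props(1)]] by blast
  then show ?thesis
    using order_word_props(2)[of "inv (order_word n R) x" n]
    by (simp add: permutes_inverses[OF order_word_props(1)])
qed

text \<open>A position is a non-record iff a larger letter stands before its letter. Speaking of
  letters and \<open>R\<close> rather than positions lets both constructions of orders be treated
  without computing the word.\<close>

lemma nonrecords_order_word:
  "nonrecords n (order_word n R) = rank_in n R ` {x \<in> {1..n}. \<exists>y\<in>{1..n}. x < y \<and> (y, x) \<in> R}"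
    (is "_ = rank_in n R ` ?X")
proof -
  let ?s = "order_word n R"
  have iff: "j \<in> nonrecords n ?s \<longleftrightarrow> ?s j \<in> ?X" if j: "j \<in> {1..n}" for j
  proof -
    have "?s j \<le> Max (?s ` {1..j})"
      using j by (intro Max_ge) auto
    then have "?s j \<noteq> Max (?s ` {1..j}) \<longleftrightarrow> ?s j < Max (?s ` {1..j})"
      by auto
    also have "\<dots> \<longleftrightarrow> (\<exists>i\<in>{1..j}. ?s j < ?s i)"
      using j by (subst Max_gr_iff) auto
    also have "\<dots> \<longleftrightarrow> (\<exists>i\<in>{1..n}. ?s j < ?s i \<and> (?s i, ?s j) \<in> R)"
    proof -
      have "(?s i, ?s j) \<in> R \<longleftrightarrow> i \<le> j" if "i \<in> {1..n}" for i
        using that j order_word_in order_word_props(2) rank_in_le_iff[of "?s i" n "?s j"] by simp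
      then show ?thesis
        using j by fastforce
    qed
    also have "\<dots> \<longleftrightarrow> (\<exists>y\<in>{1..n}. ?s j < y \<and> (y, ?s j) \<in> R)"
    proof -
      have img: "{1..n} = ?s ` {1..n}"
        using permutes_image[OF order_word_props(1)] by simp
      show ?thesis
        by (subst (2) img) (simp only: Set.bex_simps(7))
    qed
    finally show ?thesis
      using j order_word_in[OF j] by (auto simp: nonrecords_def)
  qed
  show ?thesis
  proof (intro equalityI subsetI)
    fix j
    assume j: "j \<in> nonrecords n ?s"
    then have jn: "j \<in> {1..n}"
      by (auto simp: nonrecords_def)
    have "?s j \<in> ?X"
      using iff[OF jn] j by (simp only:)
    then have "rank_in n R (?s j) \<in> rank_in n R ` ?X"
      by (rule imageI)
    then show "j \<in> rank_in n R ` ?X"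
      by (simp only: order_word_props(2)[OF jn])
  next
    fix j
    assume "j \<in> rank_in n R ` ?X"
    then obtain x where x: "x \<in> ?X" "j = rank_in n R x"
      by auto
    then have j: "j \<in> {1..n}"
      using bij_betw_rank_in[of n] by (auto simp: bij_betw_def)
    have "?s j = x"
      using x order_word_in[OF j] order_word_props(2)[OF j] bij_betw_rank_in[of n]
      by (auto simp: bij_betw_def dest: inj_onD)
    with x iff[OF j] show "j \<in> nonrecords n ?s"
      by simp
  qed
qed

end

section \<open>Measurability of the word maps\<close>

lemma topspace_orders_topology: "topspace orders_topology = orders"
proof -
  have "R \<in> \<Union> {{R \<in> orders. order_word n R = s} | n s. s permutes {1..n}}" if "R \<in> orders" for R
    using that order_word_props(1)[OF that, of 0] by blast
  then show ?thesis
    unfolding orders_topology_def topology_generated_by_topspace by blast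
qed

lemma space_orders_borel [simp]: "space orders_borel = orders"
  by (simp add: orders_borel_def topspace_orders_topology space_measure_of_conv)

lemma sets_order_word_eq: "{R \<in> orders. order_word n R = s} \<in> sets orders_borel"
proof (cases "s permutes {1..n}")
  case True
  then have "openin orders_topology {R \<in> orders. order_word n R = s}"
    unfolding orders_topology_def by (intro topology_generated_by_Basis) auto
  then show ?thesis
    unfolding orders_borel_def by (subst sets_measure_of) (auto dest: openin_subset)
next
  case False
  then have "{R \<in> orders. order_word n R = s} = {}"
    using order_word_props(1) by auto
  then show ?thesis
    by (simp only: sets.empty_sets)
qed

text \<open>Only finitely many permutations occur as words of length \<open>n\<close>, so every
  preimage is a finite union of basic open sets.\<close>

lemma measurable_order_word: "order_word n \<in> measurable orders_borel (count_space UNIV)"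
proof (rule measurableI)
  fix A :: "(nat \<Rightarrow> nat) set"
  have "order_word n -` A \<inter> orders = (\<Union>s\<in>{s. s permutes {1..n}} \<inter> A. {R \<in> orders. order_word n R = s})"
    using order_word_props(1) by auto
  also have "\<dots> \<in> sets orders_borel"
    by (intro sets.finite_UN sets_order_word_eq finite_Int disjI1 finite_permutations) auto
  finally show "order_word n -` A \<inter> space orders_borel \<in> sets orders_borel"
    by simp
qed simp

section \<open>Orders built from relative ranks\<close>

text \<open>
  The second assumption says that the number of non-records with relative rank at most \<open>m\<close> is
  \<open>o(m)\<close>.
\<close>

locale relative_ranks =
  fixes r :: "nat \<Rightarrow> nat"
  assumes r_bounds: "1 \<le> i \<Longrightarrow> 1 \<le> r i \<and> r i \<le> i"
    and r_sparse: "\<And>q. \<forall>\<^sub>F m in sequentially.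
      finite {i \<in> {1..}. r i < i \<and> r i \<le> m} \<and>
      Suc q * card {i \<in> {1..}. r i < i \<and> r i \<le> m} \<le> m"
begin

section \<open>Ranks after finitely many insertions\<close>

lemma rank_upto_self: "rank_upto r i i = r i"
  by (cases i) auto

lemma rank_upto_Suc:
  "i \<le> j \<Longrightarrow> rank_upto r i (Suc j) = rank_upto r i j + (if r (Suc j) \<le> rank_upto r i j then 1 else 0)"
  by simp

declare rank_upto.simps(2) [simp del]

lemma rank_upto_mono:
  assumes "i \<le> j" "j \<le> j'"
  shows "rank_upto r i j \<le> rank_upto r i j'"
  using assms(2) by (induction j' rule: dec_induct) (use assms(1) in \<open>auto simp: rank_upto_Suc\<close>)

lemma rank_upto_bounds:
  assumes "1 \<le> i" "i \<le> j"
  shows "1 \<le> rank_upto r i j \<and> rank_upto r i j \<le> j"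
  using assms(2)
proof (induction j rule: dec_induct)
  case base
  show ?case
    using r_bounds[OF assms(1)] by (simp add: rank_upto_self)
next
  case (step j)
  then show ?case
    by (auto simp: rank_upto_Suc)
qed

text \<open>An insertion that raises the smaller of two ranks also raises the larger one, so the
  comparison is never reversed.\<close>

lemma rank_upto_less:
  assumes "i \<le> j" "i' \<le> j" "j \<le> j'" "rank_upto r i j < rank_upto r i' j"
  shows "rank_upto r i j' < rank_upto r i' j'"
  using assms(3) by (induction j' rule: dec_induct) (use assms in \<open>auto simp: rank_upto_Suc\<close>)

text \<open>The comparison of \<open>i\<close> and \<open>l\<close> is decided when \<open>l\<close>
  is inserted at rank \<open>r l\<close>: exactly the earlier ranks that are at least
  \<open>r l\<close> move up past it.\<close>

lemma rank_upto_less_at: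
  assumes "1 \<le> i" "i < l" "l \<le> j"
  shows "if r l \<le> rank_upto r i (l - 1) then rank_upto r l j < rank_upto r i j
    else rank_upto r i j < rank_upto r l j"
proof -
  obtain k where k: "l = Suc k"
    using assms by (cases l) auto
  have at_l: "rank_upto r i l = rank_upto r i (l - 1) + (if r l \<le> rank_upto r i (l - 1) then 1 else 0)"
    using assms rank_upto_Suc[of i k] by (simp add: k)
  show ?thesis
    using assms rank_upto_less[of i l l j] rank_upto_less[of l l i j]
    by (auto simp: at_l rank_upto_self)
qed

lemma inj_on_rank_upto: "inj_on (\<lambda>i. rank_upto r i j) {1..j}"
proof (rule linorder_inj_onI)
  fix i l
  assume "i < l" "i \<in> {1..j}" "l \<in> {1..j}"
  then show "rank_upto r i j \<noteq> rank_upto r l j"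
    using rank_upto_less_at[of i l j] by (auto split: if_splits)
qed auto

lemma rank_upto_image: "(\<lambda>i. rank_upto r i j) ` {1..j} = {1..j}"
  by (rule endo_inj_surj[OF _ _ inj_on_rank_upto]) (use rank_upto_bounds in auto)

text \<open>Just before \<open>l\<close> is inserted the ranks fill \<open>{1..l - 1}\<close>, so
  some rank is at least \<open>r l\<close> iff \<open>r l \<le> l - 1\<close>.\<close>

lemma exists_larger_iff:
  assumes "1 \<le> l" "l \<le> j"
  shows "(\<exists>i\<in>{1..<l}. rank_upto r l j < rank_upto r i j) \<longleftrightarrow> r l < l"
proof -
  have iff: "rank_upto r l j < rank_upto r i j \<longleftrightarrow> r l \<le> rank_upto r i (l - 1)" if "i \<in> {1..<l}" for i
    using rank_upto_less_at[of i l j] that assms(2) by (auto split: if_splits)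
  have eq: "{1..l - 1} = {1..<l}"
    by auto
  have "(\<exists>i\<in>{1..<l}. rank_upto r l j < rank_upto r i j) \<longleftrightarrow>
      (\<exists>v\<in>(\<lambda>i. rank_upto r i (l - 1)) ` {1..l - 1}. r l \<le> v)"
    unfolding Set.bex_simps(7) eq by (rule bex_cong[OF refl iff])
  also have "\<dots> \<longleftrightarrow> (\<exists>v\<in>{1..l - 1}. r l \<le> v)"
    by (simp only: rank_upto_image)
  also have "\<dots> \<longleftrightarrow> r l < l"
    using assms(1) r_bounds[OF assms(1)] by (auto intro!: bexI[of _ "l - 1"])
  finally show ?thesis .
qed

section \<open>Sparsity of small relative ranks and the limit bijection\<close>

definition low :: "nat \<Rightarrow> nat set" where
  "low m = {i \<in> {1..}. r i < i \<and> r i \<le> m}"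

text \<open>\<open>r_sparse\<close> gives finiteness for large arguments; monotonicity of
  \<open>low\<close> extends it to all.\<close>

lemma finite_low: "finite (low m)"
proof -
  obtain m' where "m \<le> m'" "finite (low m')"
    using eventually_conj[OF r_sparse[of 0] eventually_ge_at_top[of m]]
    by (auto simp: low_def dest!: eventually_happens'[OF sequentially_bot])
  then show ?thesis
    by (elim finite_subset[rotated]) (auto simp: low_def)
qed

lemma card_low_sparse: "\<forall>\<^sub>F m in sequentially. Suc q * card (low m) \<le> m"
  using r_sparse[of q] by eventually_elim (simp add: low_def)

text \<open>
  A rank that has grown to \<open>x\<close> was raised only by non-records of relative rank less than
  \<open>x\<close>, and there are \<open>o(x)\<close> of these; hence it stays bounded.
\<close>

lemma rank_upto_le_low:
  assumes "1 \<le> i" "i \<le> j"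
  shows "rank_upto r i j \<le> r i + card {l \<in> low (rank_upto r i j). l \<le> j}"
  using assms(2)
proof (induction j rule: dec_induct)
  case base
  show ?case
    by (simp add: rank_upto_self)
next
  case (step j)
  let ?x = "rank_upto r i j" and ?y = "rank_upto r i (Suc j)"
  show ?case
  proof (cases "r (Suc j) \<le> ?x")
    case True
    then have y: "?y = Suc ?x"
      using step.hyps by (simp add: rank_upto_Suc)
    have "?x \<le> j"
      using rank_upto_bounds[OF assms(1) step.hyps(1)] by simp
    with True have "insert (Suc j) {l \<in> low ?x. l \<le> j} \<subseteq> {l \<in> low ?y. l \<le> Suc j}"
      by (auto simp: low_def y)
    then have "card (insert (Suc j) {l \<in> low ?x. l \<le> j}) \<le> card {l \<in> low ?y. l \<le> Suc j}"
      by (intro card_mono) (auto simp: finite_low)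
    with step.IH show ?thesis
      by (simp add: y finite_low)
  next
    case False
    then have y: "?y = ?x"
      using step.hyps by (simp add: rank_upto_Suc)
    have "card {l \<in> low ?x. l \<le> j} \<le> card {l \<in> low ?x. l \<le> Suc j}"
      by (intro card_mono) (auto simp: finite_low)
    with step.IH show ?thesis
      by (simp add: y)
  qed
qed

lemma rank_upto_bounded:
  assumes "1 \<le> i"
  obtains B where "\<And>j. i \<le> j \<Longrightarrow> rank_upto r i j \<le> B"
proof -
  obtain x0 where x0: "\<forall>x\<ge>x0. Suc 1 * card (low x) \<le> x"
    using card_low_sparse[of 1] unfolding eventually_sequentially by blast
  \<comment> \<open>If x is the current rank and \<open>x0 \<le> x\<close>, then x \<le> r i + card
    (low x) \<le> r i + x / 2, hence x \<le> 2 r i.\<close>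
  have "rank_upto r i j \<le> max x0 (2 * r i)" if j: "i \<le> j" for j
  proof (cases "x0 \<le> rank_upto r i j")
    case True
    have "card {l \<in> low (rank_upto r i j). l \<le> j} \<le> card (low (rank_upto r i j))"
      by (intro card_mono finite_low) auto
    moreover have "2 * card (low (rank_upto r i j)) \<le> rank_upto r i j"
      using x0[rule_format, OF True] by simp
    ultimately show ?thesis
      using rank_upto_le_low[OF assms j] by linarith
  qed auto
  with that show thesis
    by blast
qed

lemma eventually_rank_upto_const:
  assumes "1 \<le> i"
  shows "\<exists>L. \<forall>\<^sub>F j in sequentially. rank_upto r i j = L"
proof -
  obtain B where B: "\<And>j. i \<le> j \<Longrightarrow> rank_upto r i j \<le> B"
    using rank_upto_bounded[OF assms] by blast
  let ?A = "rank_upto r i ` {i..}"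
  have fin: "finite ?A"
    by (rule finite_subset[of _ "{..B}"]) (use B in auto)
  have "Max ?A \<in> ?A"
    using fin by (intro Max_in) auto
  then obtain j0 where j0: "i \<le> j0" "Max ?A = rank_upto r i j0"
    by auto
  have "rank_upto r i j = rank_upto r i j0" if "j0 \<le> j" for j
  proof (rule antisym)
    show "rank_upto r i j \<le> rank_upto r i j0"
      using fin j0(1) that by (simp flip: j0(2))
    show "rank_upto r i j0 \<le> rank_upto r i j"
      using j0(1) that by (rule rank_upto_mono)
  qed
  then show ?thesis
    by (auto simp: eventually_sequentially)
qed

lemma
  assumes "1 \<le> i"
  shows convergent_rank_upto: "convergent (\<lambda>j. rank_upto r i j)"
    and eventually_limit_rank: "\<forall>\<^sub>F j in sequentially. rank_upto r i j = limit_rank r i"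
proof -
  obtain L where L: "\<forall>\<^sub>F j in sequentially. rank_upto r i j = L"
    using eventually_rank_upto_const[OF assms] by blast
  then have lim: "(\<lambda>j. rank_upto r i j) \<longlonglongrightarrow> L"
    by (rule tendsto_eventually)
  then show "convergent (\<lambda>j. rank_upto r i j)"
    by (rule convergentI)
  show "\<forall>\<^sub>F j in sequentially. rank_upto r i j = limit_rank r i"
    using L limI[OF lim] by (simp add: limit_rank_def)
qed

lemma rank_upto_le_limit_rank:
  assumes "1 \<le> i" "i \<le> j"
  shows "rank_upto r i j \<le> limit_rank r i"
proof -
  obtain j' where "rank_upto r i j' = limit_rank r i" "j \<le> j'"
    using eventually_conj[OF eventually_limit_rank[OF assms(1)] eventually_ge_at_top[of j]]
    by (auto dest!: eventually_happens'[OF sequentially_bot])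
  then show ?thesis
    using rank_upto_mono[OF assms(2), of j'] by simp
qed

lemma limit_rank_less_iff:
  assumes "1 \<le> i" "1 \<le> i'"
  shows "\<forall>\<^sub>F j in sequentially. limit_rank r i < limit_rank r i' \<longleftrightarrow> rank_upto r i j < rank_upto r i' j"
  using eventually_limit_rank[OF assms(1)] eventually_limit_rank[OF assms(2)]
  by eventually_elim simp

text \<open>Only finitely many \<open>i < l\<close> are compared, so one late stage settles all
  comparisons and \<open>exists_larger_iff\<close> applies there.\<close>

lemma larger_limit_rank_iff:
  assumes "1 \<le> l"
  shows "(\<exists>i\<in>{1..<l}. limit_rank r l < limit_rank r i) \<longleftrightarrow> r l < l"
proof -
  have "\<forall>\<^sub>F j in sequentially. \<forall>i\<in>{1..<l}. limit_rank r l < limit_rank r i \<longleftrightarrow>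
      rank_upto r l j < rank_upto r i j"
    using assms by (intro eventually_ball_finite ballI limit_rank_less_iff) auto
  then have "\<forall>\<^sub>F j in sequentially. (\<exists>i\<in>{1..<l}. limit_rank r l < limit_rank r i) \<longleftrightarrow> r l < l"
    using eventually_ge_at_top[of l]
  proof eventually_elim
    case (elim j)
    then show ?case
      using exists_larger_iff[OF assms, of j] by simp
  qed
  then show ?thesis
    by simp
qed

text \<open>Injectivity is inherited from a late finite stage. For surjectivity, all late relative
  ranks exceed \<open>v\<close>, so the element of rank \<open>v\<close> at that time keeps it
  forever.\<close>

lemma bij_limit_rank: "bij_betw (limit_rank r) {1..} {1..}"
  unfolding bij_betw_def
proof (intro conjI equalityI subsetI)
  show "inj_on (limit_rank r) {1..}"
  proof (rule inj_onI)
    fix i i'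
    assume ii': "i \<in> {1..}" "i' \<in> {1..}" "limit_rank r i = limit_rank r i'"
    have ev: "\<forall>\<^sub>F j in sequentially. rank_upto r k j = limit_rank r k" if "k \<in> {1..}" for k
      using that by (intro eventually_limit_rank) simp
    have "\<forall>\<^sub>F j in sequentially. i = i'"
      using ev[OF ii'(1)] ev[OF ii'(2)] eventually_ge_at_top[of "max i i'"]
    proof eventually_elim
      case (elim j)
      then show ?case
        using ii' inj_onD[OF inj_on_rank_upto[of j], of i i'] by simp
    qed
    then show "i = i'"
      by simp
  qed
next
  fix v
  assume "v \<in> limit_rank r ` {1..}"
  then obtain i where i: "1 \<le> i" "v = limit_rank r i"
    by auto
  then show "v \<in> {1..}"
    using rank_upto_le_limit_rank[of i i] rank_upto_bounds[of i i] by auto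
next
  fix v :: nat
  assume "v \<in> {1..}"
  obtain J0 where J0: "low v \<subseteq> {..J0}"
    using finite_low finite_nat_iff_bounded_le by blast
  \<comment> \<open>Beyond \<open>J0\<close> no index lies in \<open>low v\<close>. Taking
    \<open>v \<le> J\<close> also excludes late records with rank at most \<open>v\<close> and puts
    \<open>v\<close> among the ranks at stage \<open>J\<close>.\<close>
  define J where "J = max J0 v"
  have r_gt: "v < r (Suc j)" if "J \<le> j" for j
  proof (rule ccontr)
    assume "\<not> v < r (Suc j)"
    with that have "Suc j \<in> low v"
      by (auto simp: low_def J_def)
    with J0 that show False
      by (auto simp: J_def)
  qed
  have "v \<in> (\<lambda>i. rank_upto r i J) ` {1..J}"
    using \<open>v \<in> {1..}\<close> by (simp only: rank_upto_image) (auto simp: J_def)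
  then obtain i where i: "1 \<le> i" "i \<le> J" "rank_upto r i J = v"
    by auto
  have "rank_upto r i j = v" if "J \<le> j" for j
    using that
  proof (induction j rule: dec_induct)
    case base
    show ?case
      by (fact i(3))
  next
    case (step j)
    then show ?case
      using r_gt[of j] i(2) by (simp add: rank_upto_Suc)
  qed
  then have "\<forall>\<^sub>F j in sequentially. rank_upto r i j = v"
    by (auto simp: eventually_sequentially)
  then have "\<forall>\<^sub>F j in sequentially. limit_rank r i = v"
    using eventually_limit_rank[OF i(1)] by eventually_elim simp
  then show "v \<in> limit_rank r ` {1..}"
    using i(1) by auto
qed

section \<open>The order given by the limit ranks\<close>

text \<open>Inverse of the bijection \<sigma> of the construction: the position of a letter in the
  infinite word \<open>limit_rank r 1\<close>, \<open>limit_rank r 2\<close>, and so on.\<close>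

definition place :: "nat \<Rightarrow> nat" where
  "place = inv_into {1..} (limit_rank r)"

lemma limit_rank_place: "1 \<le> v \<Longrightarrow> limit_rank r (place v) = v"
  using bij_betw_inv_into_right[OF bij_limit_rank] by (auto simp: place_def)

lemma place_limit_rank: "1 \<le> l \<Longrightarrow> place (limit_rank r l) = l"
  using bij_betw_inv_into_left[OF bij_limit_rank] by (auto simp: place_def)

lemma place_ge: "1 \<le> v \<Longrightarrow> 1 \<le> place v"
  using bij_betw_inv_into[OF bij_limit_rank] by (auto simp: bij_betw_def place_def)

lemma limit_rank_ge: "1 \<le> l \<Longrightarrow> 1 \<le> limit_rank r l"
  using bij_limit_rank by (auto simp: bij_betw_def)

lemma limit_rank_eq_iff: "1 \<le> l \<Longrightarrow> 1 \<le> l' \<Longrightarrow> limit_rank r l = limit_rank r l' \<longleftrightarrow> l = l'"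
  by (metis place_limit_rank)

lemma order_of_ranks_iff:
  "(x, y) \<in> order_of_ranks r \<longleftrightarrow> 1 \<le> x \<and> 1 \<le> y \<and> place x \<le> place y"
  using convergent_rank_upto bij_limit_rank unfolding order_of_ranks_def place_def by auto

lemma order_of_ranks_in_orders: "order_of_ranks r \<in> orders"
  unfolding orders_iff
proof (intro conjI)
  show "antisym (order_of_ranks r)"
    by (rule antisymI) (metis antisym order_of_ranks_iff limit_rank_place)
qed (auto simp: order_of_ranks_iff intro!: transI)

text \<open>The finite word arises from the infinite one by deleting the letters above
  \<open>m\<close>, so a position drops by the number of deletions before it.\<close>

lemma rank_in_order_of_ranks:
  assumes "1 \<le> l"
  shows "rank_in m (order_of_ranks r) (limit_rank r l) = card {i \<in> {1..l}. limit_rank r i \<le> m}"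
proof -
  have "{x \<in> {1..m}. (x, limit_rank r l) \<in> order_of_ranks r} =
      limit_rank r ` {i \<in> {1..l}. limit_rank r i \<le> m}"
  proof (intro equalityI subsetI)
    fix x
    assume x: "x \<in> {x \<in> {1..m}. (x, limit_rank r l) \<in> order_of_ranks r}"
    then have "limit_rank r (place x) = x" "1 \<le> place x" "place x \<le> l" "x \<le> m"
      using assms limit_rank_place[of x] place_ge[of x] place_limit_rank[of l]
      by (auto simp: order_of_ranks_iff)
    then show "x \<in> limit_rank r ` {i \<in> {1..l}. limit_rank r i \<le> m}"
      by (intro image_eqI[of _ _ "place x"]) auto
  next
    fix x
    assume "x \<in> limit_rank r ` {i \<in> {1..l}. limit_rank r i \<le> m}"
    then obtain i where "1 \<le> i" "i \<le> l" "limit_rank r i \<le> m" "x = limit_rank r i"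
      by auto
    then show "x \<in> {x \<in> {1..m}. (x, limit_rank r l) \<in> order_of_ranks r}"
      using assms limit_rank_ge[of i] limit_rank_ge[of l] place_limit_rank[of i] place_limit_rank[of l]
      by (simp add: order_of_ranks_iff)
  qed
  moreover have "inj_on (limit_rank r) {i \<in> {1..l}. limit_rank r i \<le> m}"
    using bij_limit_rank by (auto simp: bij_betw_def intro: inj_on_subset)
  ultimately show ?thesis
    by (simp add: rank_in_def card_image)
qed

text \<open>Once \<open>m\<close> is at least each of the first \<open>M\<close> letters of the
  infinite word, nothing is deleted among them, and position \<open>l\<close> still holds
  \<open>limit_rank r l\<close>.\<close>

lemma initial_nonrecords:
  "\<forall>\<^sub>F m in sequentially.
     nonrecords m (order_word m (order_of_ranks r)) \<inter> {1..M} = {l \<in> {1..M}. r l < l}"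
proof -
  let ?R = "order_of_ranks r"
  have "\<forall>\<^sub>F m in sequentially. \<forall>i\<in>{1..M}. limit_rank r i \<le> m"
    by (intro eventually_ball_finite ballI eventually_ge_at_top) auto
  then show ?thesis
  proof eventually_elim
    fix m
    assume m: "\<forall>i\<in>{1..M}. limit_rank r i \<le> m"
    have rank: "rank_in m ?R (limit_rank r l) = l" if "l \<in> {1..M}" for l
    proof -
      have "{i \<in> {1..l}. limit_rank r i \<le> m} = {1..l}"
        using that m by auto
      then show ?thesis
        using that by (simp add: rank_in_order_of_ranks)
    qed
    have "l \<in> nonrecords m (order_word m ?R) \<longleftrightarrow> r l < l" if l: "l \<in> {1..M}" for l
    proof -
      have lm: "limit_rank r l \<in> {1..m}"
        using l m limit_rank_ge[of l] by auto
      have "l \<in> nonrecords m (order_word m ?R) \<longleftrightarrow>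
          (\<exists>y\<in>{1..m}. limit_rank r l < y \<and> (y, limit_rank r l) \<in> ?R)"
      proof -
        have iff: "l = rank_in m ?R x \<longleftrightarrow> x = limit_rank r l" if "x \<in> {1..m}" for x
          using bij_betw_rank_in[OF order_of_ranks_in_orders, of m] rank[OF l] that lm
          by (metis bij_betw_def inj_onD)
        have "l \<in> nonrecords m (order_word m ?R) \<longleftrightarrow>
            (\<exists>x\<in>{1..m}. l = rank_in m ?R x \<and> (\<exists>y\<in>{1..m}. x < y \<and> (y, x) \<in> ?R))"
          unfolding nonrecords_order_word[OF order_of_ranks_in_orders] by blast
        also have "\<dots> \<longleftrightarrow> (\<exists>x\<in>{1..m}. x = limit_rank r l \<and> (\<exists>y\<in>{1..m}. x < y \<and> (y, x) \<in> ?R))"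
          by (intro bex_cong refl) (simp only: iff)
        also have "\<dots> \<longleftrightarrow> (\<exists>y\<in>{1..m}. limit_rank r l < y \<and> (y, limit_rank r l) \<in> ?R)"
          using lm by blast
        finally show ?thesis .
      qed
      \<comment> \<open>The two witnesses correspond through \<open>place\<close>; the bound by
        \<open>m\<close> in the converse comes from the choice of \<open>m\<close>.\<close>
      also have "\<dots> \<longleftrightarrow> (\<exists>i\<in>{1..<l}. limit_rank r l < limit_rank r i)"
      proof
        assume "\<exists>y\<in>{1..m}. limit_rank r l < y \<and> (y, limit_rank r l) \<in> ?R"
        then obtain y where y: "1 \<le> y" "limit_rank r l < y" "place y \<le> l"
          using l by (auto simp: order_of_ranks_iff place_limit_rank)
        then have "limit_rank r (place y) = y" "place y \<noteq> l" "1 \<le> place y"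
          using limit_rank_place[of y] place_ge[of y] by auto
        with y show "\<exists>i\<in>{1..<l}. limit_rank r l < limit_rank r i"
          by (intro bexI[of _ "place y"]) auto
      next
        assume "\<exists>i\<in>{1..<l}. limit_rank r l < limit_rank r i"
        then obtain i where "1 \<le> i" "i < l" "limit_rank r l < limit_rank r i"
          by auto
        with l m show "\<exists>y\<in>{1..m}. limit_rank r l < y \<and> (y, limit_rank r l) \<in> ?R"
          using limit_rank_ge[of i] limit_rank_ge[of l]
          by (intro bexI[of _ "limit_rank r i"]) (auto simp: order_of_ranks_iff place_limit_rank)
      qed
      also have "\<dots> \<longleftrightarrow> r l < l"
        using l by (intro larger_limit_rank_iff) auto
      finally show ?thesis .
    qed
    then show "nonrecords m (order_word m ?R) \<inter> {1..M} = {l \<in> {1..M}. r l < l}"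
      by auto
  qed
qed

text \<open>
  The letters to the right of \<open>m\<close> in the word are smaller than \<open>m\<close>, so they sit at
  non-record places and have relative rank at most \<open>m\<close>.
\<close>

lemma le_rank_in_plus_low:
  assumes "1 \<le> m"
  shows "m \<le> rank_in m (order_of_ranks r) m + card (low m)"
proof -
  define l where "l = place m"
  have l: "1 \<le> l" "limit_rank r l = m"
    using assms by (simp_all add: l_def place_ge[simplified] limit_rank_place)
  let ?early = "{i \<in> {1..l}. limit_rank r i \<le> m}"
  have "{1..m} \<subseteq> limit_rank r ` (?early \<union> low m)"
  proof
    fix v
    assume v: "v \<in> {1..m}"
    define i where "i = place v"
    have i: "1 \<le> i" "limit_rank r i = v"
      using v by (simp_all add: i_def place_ge[simplified] limit_rank_place)
    have "i \<in> ?early \<union> low m"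
    proof (cases "i \<le> l")
      case True
      with i v show ?thesis
        by auto
    next
      case False
      with i l v have "limit_rank r i < limit_rank r l"
        by (metis atLeastAtMost_iff le_neq_implies_less limit_rank_eq_iff order.refl)
      with l False have "\<exists>i'\<in>{1..<i}. limit_rank r i < limit_rank r i'"
        by (intro bexI[of _ l]) auto
      then have "r i < i"
        using larger_limit_rank_iff[OF i(1)] by simp
      \<comment> \<open>A relative rank is the initial value of a nondecreasing sequence with limit
        \<open>v \<le> m\<close>.\<close>
      moreover have "r i \<le> m"
        using rank_upto_le_limit_rank[OF i(1) order.refl] i v by (simp add: rank_upto_self)
      ultimately show ?thesis
        using i(1) by (auto simp: low_def)
    qed
    with i(2) show "v \<in> limit_rank r ` (?early \<union> low m)"
      by blast
  qed
  then have "card {1..m} \<le> card (limit_rank r ` (?early \<union> low m))"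
    by (intro card_mono) (auto simp: finite_low)
  also have "\<dots> \<le> card (?early \<union> low m)"
    by (intro card_image_le) (auto simp: finite_low)
  also have "\<dots> \<le> card ?early + card (low m)"
    by (rule card_Un_le)
  finally show ?thesis
    using rank_in_order_of_ranks[OF l(1), of m] l(2) by simp
qed

text \<open>The position of letter \<open>m\<close> is at least m (1 - 1 / (q + 1)); clearing the
  denominator keeps the statement in the naturals.\<close>

lemma max_letter_near_end:
  "\<forall>\<^sub>F m in sequentially. Suc q * m \<le> Suc q * rank_in m (order_of_ranks r) m + m"
  using card_low_sparse[of q] eventually_ge_at_top[of 1]
proof eventually_elim
  case (elim m)
  have "Suc q * m \<le> Suc q * (rank_in m (order_of_ranks r) m + card (low m))"
    using le_rank_in_plus_low[OF elim(2)] by (rule mult_le_mono2)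
  with elim(1) show ?case
    by (simp add: distrib_left)
qed

end

section \<open>Concatenated orders\<close>

text \<open>Plays two parts: on an infinite \<open>N\<close> of positive integers it is the
  increasing bijection of \<open>transport_order\<close>, and for arbitrary \<open>n\<close> it is
  the length of the initial segment of the word that the letters of \<open>N\<close> occupy.\<close>

definition count_upto :: "nat set \<Rightarrow> nat \<Rightarrow> nat" where
  "count_upto N n = card (N \<inter> {1..n})"

lemma count_upto_le: "count_upto N n \<le> n"
  unfolding count_upto_def by (rule order.trans[OF card_mono[of "{1..n}"]]) auto

lemma count_upto_mono: "m \<le> n \<Longrightarrow> count_upto N m \<le> count_upto N n"
  unfolding count_upto_def by (intro card_mono) auto

lemma count_upto_less:
  assumes "N \<subseteq> {1..}" "m < n" "n \<in> N"
  shows "count_upto N m < count_upto N n"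
proof -
  have "n \<in> N \<inter> {1..n}" "n \<notin> N \<inter> {1..m}" "N \<inter> {1..m} \<subseteq> N \<inter> {1..n}"
    using assms by auto
  then show ?thesis
    unfolding count_upto_def by (intro psubset_card_mono) auto
qed

lemma count_upto_less_iff:
  assumes "N \<subseteq> {1..}" "m \<in> N" "n \<in> N"
  shows "count_upto N m < count_upto N n \<longleftrightarrow> m < n"
  using count_upto_less[OF assms(1) _ assms(2), of n] count_upto_less[OF assms(1) _ assms(3), of m]
  by (cases m n rule: linorder_cases) auto

lemma inj_on_count_upto: "N \<subseteq> {1..} \<Longrightarrow> inj_on (count_upto N) N"
  by (rule inj_onI) (metis count_upto_less_iff linorder_neq_iff)

lemma count_upto_image:
  assumes "N \<subseteq> {1..}"
  shows "count_upto N ` (N \<inter> {1..n}) = {1..count_upto N n}"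
proof (rule card_subset_eq)
  have "1 \<le> count_upto N x" if "x \<in> N" for x
    using count_upto_less[OF assms _ that, of 0] that assms by fastforce
  then show "count_upto N ` (N \<inter> {1..n}) \<subseteq> {1..count_upto N n}"
    using count_upto_mono[of _ n N] by auto
  have "inj_on (count_upto N) (N \<inter> {1..n})"
    using inj_on_count_upto[OF assms] by (rule inj_on_subset) auto
  then show "card (count_upto N ` (N \<inter> {1..n})) = card {1..count_upto N n}"
    by (simp add: card_image) (simp add: count_upto_def)
qed simp

lemma concat_order_iff:
  assumes "x \<in> N1"
  shows "(i, x) \<in> concat_order N1 R1 R2 \<longleftrightarrow> i \<in> N1 \<and> (count_upto N1 i, count_upto N1 x) \<in> R1"
  using assms by (auto simp: concat_order_def transport_order_def count_upto_def Let_def)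

lemma concat_order_before:
  assumes "i \<in> N1" "1 \<le> x" "x \<notin> N1"
  shows "(i, x) \<in> concat_order N1 R1 R2"
  using assms by (auto simp: concat_order_def Let_def)

context
  fixes N1 :: "nat set" and R1 R2 :: "nat rel"
  assumes N1: "N1 \<subseteq> {1..}" and R1: "R1 \<in> orders" and R: "concat_order N1 R1 R2 \<in> orders"
begin

text \<open>All predecessors of a letter of \<open>N1\<close> lie in \<open>N1\<close>, and
  \<open>count_upto\<close> matches those up to \<open>n\<close> with predecessors under
  \<open>R1\<close>.\<close>

lemma rank_in_concat_order:
  assumes x: "x \<in> N1" "x \<le> n"
  shows "rank_in n (concat_order N1 R1 R2) x = rank_in (count_upto N1 n) R1 (count_upto N1 x)"
proof -
  let ?c = "count_upto N1"
  have eq: "{i \<in> {1..n}. (i, x) \<in> concat_order N1 R1 R2} = {i \<in> N1 \<inter> {1..n}. (?c i, ?c x) \<in> R1}"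
    using x N1 by (auto simp: concat_order_iff)
  have img: "?c ` {i \<in> N1 \<inter> {1..n}. (?c i, ?c x) \<in> R1} = {j \<in> {1..?c n}. (j, ?c x) \<in> R1}"
    unfolding count_upto_image[OF N1, symmetric] by blast
  have "inj_on ?c {i \<in> N1 \<inter> {1..n}. (?c i, ?c x) \<in> R1}"
    using inj_on_count_upto[OF N1] by (rule inj_on_subset) auto
  then have "card {i \<in> N1 \<inter> {1..n}. (?c i, ?c x) \<in> R1} = card {j \<in> {1..?c n}. (j, ?c x) \<in> R1}"
    by (simp only: card_image flip: img)
  then show ?thesis
    unfolding rank_in_def by (simp only: eq)
qed

lemma rank_in_concat_order_upper:
  assumes x: "x \<in> {1..n}" "x \<notin> N1"
  shows "count_upto N1 n < rank_in n (concat_order N1 R1 R2) x"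
proof -
  have "insert x (N1 \<inter> {1..n}) \<subseteq> {i \<in> {1..n}. (i, x) \<in> concat_order N1 R1 R2}"
    using x R by (auto simp: concat_order_before orders_iff)
  then have "card (insert x (N1 \<inter> {1..n})) \<le> rank_in n (concat_order N1 R1 R2) x"
    unfolding rank_in_def by (intro card_mono) auto
  then show ?thesis
    using x by (simp add: count_upto_def)
qed

text \<open>Whether a letter of \<open>N1\<close> is at a non-record depends on letters before it,
  which are again in \<open>N1\<close>; \<open>count_upto\<close> respects both their size and their
  order.\<close>

lemma nonrecords_concat_order:
  "nonrecords n (order_word n (concat_order N1 R1 R2)) \<inter> {1..count_upto N1 n} =
     nonrecords (count_upto N1 n) (order_word (count_upto N1 n) R1)"
proof -
  let ?c = "count_upto N1" and ?R = "concat_order N1 R1 R2"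
  let ?X = "{x \<in> {1..n}. \<exists>y\<in>{1..n}. x < y \<and> (y, x) \<in> ?R}"
  have "nonrecords n (order_word n ?R) \<inter> {1..?c n} = rank_in n ?R ` ?X \<inter> {1..?c n}"
    by (simp only: nonrecords_order_word[OF R])
  \<comment> \<open>The letters of \<open>N1\<close> have rank at most \<open>?c n\<close> and all
    others have larger rank.\<close>
  also have "\<dots> = rank_in n ?R ` (?X \<inter> N1)"
  proof (intro equalityI subsetI)
    fix j
    assume "j \<in> rank_in n ?R ` ?X \<inter> {1..?c n}"
    then obtain x where x: "x \<in> ?X" "j = rank_in n ?R x" "j \<le> ?c n"
      by auto
    then have "x \<in> N1"
      using rank_in_concat_order_upper[of x n] by fastforce
    with x show "j \<in> rank_in n ?R ` (?X \<inter> N1)"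
      by blast
  next
    fix j
    assume "j \<in> rank_in n ?R ` (?X \<inter> N1)"
    then obtain x where x: "x \<in> ?X" "x \<in> N1" "j = rank_in n ?R x"
      by blast
    then have "1 \<le> j" "j \<le> ?c n"
      using rank_in_bounds(2)[OF R, of x n] rank_in_bounds(1)[OF R1, of "?c n" "?c x"]
      by (auto simp: rank_in_concat_order)
    with x show "j \<in> rank_in n ?R ` ?X \<inter> {1..?c n}"
      by auto
  qed
  also have "\<dots> = (\<lambda>x. rank_in (?c n) R1 (?c x)) ` (?X \<inter> N1)"
    by (intro image_cong refl) (auto simp: rank_in_concat_order)
  also have "?X \<inter> N1 = {x \<in> N1 \<inter> {1..n}. \<exists>y\<in>N1 \<inter> {1..n}. ?c x < ?c y \<and> (?c y, ?c x) \<in> R1}"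
  proof -
    have bex: "(\<exists>y\<in>{1..n}. x < y \<and> (y, x) \<in> ?R) \<longleftrightarrow>
        (\<exists>y\<in>N1 \<inter> {1..n}. ?c x < ?c y \<and> (?c y, ?c x) \<in> R1)" if "x \<in> N1" for x
      unfolding Bex_def using that
      by (intro arg_cong[where f = Ex] ext) (auto simp: concat_order_iff count_upto_less_iff[OF N1])
    have "?X \<inter> N1 = {x \<in> N1 \<inter> {1..n}. \<exists>y\<in>{1..n}. x < y \<and> (y, x) \<in> ?R}"
      by blast
    also have "\<dots> = {x \<in> N1 \<inter> {1..n}. \<exists>y\<in>N1 \<inter> {1..n}. ?c x < ?c y \<and> (?c y, ?c x) \<in> R1}"
      by (intro Collect_cong conj_cong refl bex) simp
    finally show ?thesis .
  qed
  also have "(\<lambda>x. rank_in (?c n) R1 (?c x)) ` \<dots> =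
      rank_in (?c n) R1 ` {x \<in> ?c ` (N1 \<inter> {1..n}). \<exists>y\<in>?c ` (N1 \<inter> {1..n}). x < y \<and> (y, x) \<in> R1}"
    by auto
  also have "\<dots> = nonrecords (?c n) (order_word (?c n) R1)"
    by (simp only: count_upto_image[OF N1] nonrecords_order_word[OF R1])
  finally show ?thesis .
qed

end

text \<open>Meant for \<open>u n\<close> the proportion of \<open>N1\<close> in
  \<open>{1..n}\<close> and \<open>x n\<close> the relative position of letter \<open>n\<close>: the
  lower estimate holds for all large \<open>n\<close>, the upper one whenever
  \<open>n \<in> N1\<close>.\<close>

lemma liminf_eqI:
  fixes x u :: "nat \<Rightarrow> real"
  assumes u: "u \<longlonglongrightarrow> p"
    and lower: "\<And>\<epsilon>. 0 < \<epsilon> \<Longrightarrow> \<forall>\<^sub>F n in sequentially. u n - \<epsilon> \<le> x n"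
    and upper: "\<exists>\<^sub>F n in sequentially. x n \<le> u n"
  shows "liminf (\<lambda>n. ereal (x n)) = ereal p"
proof (rule antisym)
  show "liminf (\<lambda>n. ereal (x n)) \<le> ereal p"
  proof (rule ccontr)
    assume "\<not> liminf (\<lambda>n. ereal (x n)) \<le> ereal p"
    then obtain y where y: "ereal p < ereal y" "ereal y < liminf (\<lambda>n. ereal (x n))"
      using ereal_dense2[of "ereal p"] unfolding not_le by blast
    have "\<forall>\<^sub>F n in sequentially. y < x n"
      using less_LiminfD[OF y(2)] by simp
    moreover have "\<forall>\<^sub>F n in sequentially. u n < y"
      using order_tendstoD(2)[OF u] y(1) by simp
    ultimately have "\<forall>\<^sub>F n in sequentially. \<not> x n \<le> u n"
      by eventually_elim auto
    with upper show False
      by (simp add: frequently_def)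
  qed
  show "ereal p \<le> liminf (\<lambda>n. ereal (x n))"
    unfolding le_Liminf_iff
  proof (intro allI impI)
    fix y :: ereal
    assume "y < ereal p"
    then obtain z where z: "y < ereal z" "z < p"
      using ereal_dense2[of y "ereal p"] by auto
    define \<epsilon> where "\<epsilon> = (p - z) / 2"
    have "\<forall>\<^sub>F n in sequentially. z + \<epsilon> < u n"
      using z(2) by (intro order_tendstoD(1)[OF u]) (simp add: \<epsilon>_def field_simps)
    moreover have "\<forall>\<^sub>F n in sequentially. u n - \<epsilon> \<le> x n"
      using z(2) by (intro lower) (simp add: \<epsilon>_def)
    ultimately show "\<forall>\<^sub>F n in sequentially. y < ereal (x n)"
    proof eventually_elim
      case (elim n)
      then have "ereal z < ereal (x n)"
        by simp
      with z(1) show ?case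
        by (rule less_trans)
    qed
  qed
qed

text \<open>
  Only the letters of \<open>N1\<close> matter: they occupy an initial segment of the word, and every other
  letter comes after all of them.
\<close>

lemma concat_order_limits:
  assumes N1: "N1 \<subseteq> {1..}" and R1: "R1 \<in> orders" and R: "concat_order N1 R1 R2 \<in> orders"
    and density: "(\<lambda>n. count_upto N1 n / real n) \<longlonglongrightarrow> p" and "0 < p"
    and nonrec: "\<And>M. \<forall>\<^sub>F m in sequentially. nonrecords m (order_word m R1) \<inter> {1..M} = S \<inter> {1..M}"
    and last: "\<And>q. \<forall>\<^sub>F m in sequentially. Suc q * m \<le> Suc q * inv (order_word m R1) m + m"
  defines "R \<equiv> concat_order N1 R1 R2"
  shows "\<forall>\<^sub>F n in sequentially. nonrecords n (order_word n R) \<inter> {1..M} = S \<inter> {1..M}"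
    and "liminf (\<lambda>n. ereal (real (inv (order_word n R) n) / real n)) = ereal p"
proof -
  let ?c = "count_upto N1"
  \<comment> \<open>Positive density makes \<open>?c n\<close> tend to infinity, so eventual
    statements about words of \<open>R1\<close> may be read at length \<open>?c n\<close>.\<close>
  have "filterlim (\<lambda>n. ?c n / real n * real n) at_top sequentially"
    using density \<open>0 < p\<close> filterlim_real_sequentially by (rule filterlim_tendsto_pos_mult_at_top)
  moreover have "\<forall>\<^sub>F n in sequentially. ?c n / real n * real n = real (?c n)"
    using eventually_gt_at_top[of 0] by eventually_elim simp
  ultimately have "filterlim (\<lambda>n. real (?c n)) at_top sequentially"
    by (rule filterlim_mono_eventually[OF _ order.refl order.refl])
  then have c_top: "filterlim ?c at_top sequentially"
    by (simp add: filterlim_sequentially_iff_filterlim_real)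
  have transfer: "\<forall>\<^sub>F n in sequentially. P (?c n)" if "\<forall>\<^sub>F m in sequentially. P m" for P
    using that c_top by (rule eventually_compose_filterlim)

  have "\<forall>\<^sub>F n in sequentially. nonrecords (?c n) (order_word (?c n) R1) \<inter> {1..M} = S \<inter> {1..M}
      \<and> M \<le> ?c n"
    by (rule transfer) (intro eventually_conj nonrec eventually_ge_at_top)
  then show "\<forall>\<^sub>F n in sequentially. nonrecords n (order_word n R) \<inter> {1..M} = S \<inter> {1..M}"
  proof eventually_elim
    case (elim n)
    then have "{1..?c n} \<inter> {1..M} = {1..M}"
      by auto
    with elim show ?case
      using nonrecords_concat_order[OF N1 R1 R, of n] by (simp only: R_def) blast
  qed

  have inv_R: "inv (order_word n R) n = rank_in n R n" if "1 \<le> n" for n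
    using inv_order_word[OF R, of n n] that by (simp add: R_def)
  have rank_N1: "rank_in n R n = rank_in (?c n) R1 (?c n)" if "n \<in> N1" for n
    using rank_in_concat_order[OF N1 R1 R that order.refl] by (simp add: R_def)
  have "infinite N1"
  proof
    assume "finite N1"
    then have "?c n \<le> card N1" for n
      unfolding count_upto_def by (intro card_mono) auto
    moreover obtain n where "Suc (card N1) \<le> ?c n"
      using c_top unfolding filterlim_at_top by (auto simp: eventually_sequentially)
    ultimately show False
      using not_less_eq_eq by blast
  qed
  then have often: "\<exists>\<^sub>F n in sequentially. n \<in> N1"
    by (simp add: frequently_cofinite flip: cofinite_eq_sequentially)
  show "liminf (\<lambda>n. ereal (real (inv (order_word n R) n) / real n)) = ereal p"
  proof (rule liminf_eqI[OF density])
    show "\<exists>\<^sub>F n in sequentially. real (inv (order_word n R) n) / real n \<le> ?c n / real n"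
      using often
    proof (rule frequently_elim1)
      fix n
      assume n: "n \<in> N1"
      with N1 have "inv (order_word n R) n \<le> ?c n"
        using rank_in_bounds(1)[OF R1, of "?c n" "?c n"] inv_R[of n] rank_N1[OF n] by auto
      then show "real (inv (order_word n R) n) / real n \<le> ?c n / real n"
        by (intro divide_right_mono) auto
    qed
  next
    fix \<epsilon> :: real
    assume "0 < \<epsilon>"
    then obtain q where q: "1 / real (Suc q) < \<epsilon>"
      using reals_Archimedean by (auto simp: inverse_eq_divide)
    show "\<forall>\<^sub>F n in sequentially. ?c n / real n - \<epsilon> \<le> real (inv (order_word n R) n) / real n"
      using transfer[OF eventually_conj[OF last[of q] eventually_ge_at_top[of 1]]]
        eventually_ge_at_top[of 1]
    proof eventually_elim
      case (elim n)
      \<comment> \<open>For \<open>n \<in> N1\<close> the letter \<open>n\<close> corresponds to the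
        largest letter \<open>?c n\<close> of the word of \<open>R1\<close>, so \<open>last\<close>
        applies; otherwise it stands beyond position \<open>?c n\<close>.\<close>
      have "Suc q * ?c n \<le> Suc q * inv (order_word n R) n + ?c n"
      proof (cases "n \<in> N1")
        case True
        with elim inv_order_word[OF R1, of "?c n" "?c n"] show ?thesis
          by (simp add: inv_R rank_N1)
      next
        case False
        then have "?c n \<le> inv (order_word n R) n"
          using rank_in_concat_order_upper[OF N1 R1 R, of n n] elim(2) inv_R[of n] by (simp add: R_def)
        then show ?thesis
          by (meson mult_le_mono2 trans_le_add1)
      qed
      \<comment> \<open>Enlarging the error term from \<open>?c n\<close> to \<open>n\<close> makes
        it 1 / (q + 1) after division.\<close>
      then have "real (Suc q) * ?c n \<le> real (Suc q) * inv (order_word n R) n + n"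
        using count_upto_le[of N1 n] by (simp only: flip: of_nat_mult of_nat_add)
      then have "?c n / real n - 1 / real (Suc q) \<le> real (inv (order_word n R) n) / real n"
        using elim(2) by (simp add: divide_simps del: of_nat_Suc) (simp add: algebra_simps)
      with q show ?case
        by linarith
    qed
  qed
qed

section \<open>The kth element of sets that stabilise on initial segments\<close>

text \<open>Characterises the kth element by the number of elements up to it, a property that sees
  only an initial part of \<open>X\<close>.\<close>

lemma nth_sorted_list_of_set_props:
  fixes X :: "nat set"
  assumes "finite X" "1 \<le> k" "k \<le> card X"
  defines "x \<equiv> sorted_list_of_set X ! (k - 1)"
  shows "x \<in> X" "card {y \<in> X. y \<le> x} = k"
proof -
  let ?xs = "sorted_list_of_set X"
  have len: "length ?xs = card X" and set: "set ?xs = X"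
    using assms(1) by simp_all
  then show "x \<in> X"
    using assms(2,3) nth_mem[of "k - 1" ?xs] by (simp add: x_def)
  have less: "?xs ! i < ?xs ! j" if "i < j" "j < card X" for i j
    using that sorted_wrt_nth_less[OF strict_sorted_list_of_set, of i j X] len by simp
  have "{y \<in> X. y \<le> x} = (\<lambda>i. ?xs ! i) ` {..<k}"
  proof (intro equalityI subsetI)
    fix y
    assume y: "y \<in> {y \<in> X. y \<le> x}"
    then have "y \<in> set ?xs"
      using set by simp
    then obtain i where i: "i < card X" "y = ?xs ! i"
      unfolding in_set_conv_nth len by blast
    have "i < k"
    proof (rule ccontr)
      assume "\<not> i < k"
      with i(1) assms(2) have "x < y"
        using less[of "k - 1" i] by (simp add: x_def i(2))
      with y show False
        by simp
    qed
    with i show "y \<in> (\<lambda>i. ?xs ! i) ` {..<k}"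
      by simp
  next
    fix y
    assume "y \<in> (\<lambda>i. ?xs ! i) ` {..<k}"
    then obtain i where i: "i < k" "y = ?xs ! i"
      by auto
    then have "y \<in> X"
      using assms(3) nth_mem[of i ?xs] by (simp add: len set)
    moreover have "y \<le> x"
    proof (cases "i = k - 1")
      case False
      with i assms(2,3) have "i < k - 1" "k - 1 < card X"
        by auto
      then show ?thesis
        using less by (simp add: i(2) x_def less_imp_le)
    qed (simp add: i(2) x_def)
    ultimately show "y \<in> {y \<in> X. y \<le> x}"
      by simp
  qed
  moreover have "inj_on (\<lambda>i. ?xs ! i) {..<k}"
    using assms(3) less by (intro linorder_inj_onI) fastforce+
  ultimately show "card {y \<in> X. y \<le> x} = k"
    by (simp add: card_image)
qed

context
  fixes N :: "nat \<Rightarrow> nat set" and S :: "nat set"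
  assumes N: "\<And>n. finite (N n)" "\<And>n. N n \<subseteq> {1..}"
    and S: "S \<subseteq> {1..}"
    and initial: "\<And>M. \<forall>\<^sub>F n in sequentially. N n \<inter> {1..M} = S \<inter> {1..M}"
begin

lemma initial_iff: "\<forall>\<^sub>F n in sequentially. \<forall>y\<le>M. y \<in> N n \<longleftrightarrow> y \<in> S"
  using initial[of M]
proof eventually_elim
  case (elim n)
  show ?case
  proof (intro allI impI)
    fix y
    assume "y \<le> M"
    from elim have "y \<in> N n \<inter> {1..M} \<longleftrightarrow> y \<in> S \<inter> {1..M}"
      by (simp only:)
    with \<open>y \<le> M\<close> N(2)[of n] S show "y \<in> N n \<longleftrightarrow> y \<in> S"
      by auto
  qed
qed

text \<open>Once \<open>N n\<close> agrees with \<open>S\<close> up to \<open>t\<close>, the element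
  \<open>t\<close> has the count that identifies the kth element of \<open>N n\<close>.\<close>

lemma eventually_kth_element:
  assumes t: "t \<in> S" "card {y \<in> S. y \<le> t} = k"
  shows "\<forall>\<^sub>F n in sequentially. k \<le> card (N n) \<and> sorted_list_of_set (N n) ! (k - 1) = t"
  using initial_iff[of t]
proof eventually_elim
  case (elim n)
  have eq: "{y \<in> N n. y \<le> t} = {y \<in> S. y \<le> t}"
    using elim by auto
  with t have tn: "t \<in> N n" and card_t: "card {y \<in> N n. y \<le> t} = k"
    by auto
  have "0 < card {y \<in> N n. y \<le> t}"
    using tn N(1)[of n] by (subst card_gt_0_iff) auto
  then have k: "1 \<le> k"
    by (simp add: card_t)
  have k_le: "k \<le> card (N n)"
    unfolding card_t[symmetric] using N(1) by (intro card_mono) auto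
  define x where "x = sorted_list_of_set (N n) ! (k - 1)"
  have x: "x \<in> N n" "card {y \<in> N n. y \<le> x} = k"
    using nth_sorted_list_of_set_props[OF N(1) k k_le] by (simp_all add: x_def)
  \<comment> \<open>Counts increase strictly along the elements of \<open>N n\<close>, so equal
    counts force equal elements.\<close>
  have "\<not> x < t" if "x \<in> N n" "t \<in> N n" "card {y \<in> N n. y \<le> x} = card {y \<in> N n. y \<le> t}" for x t
  proof
    assume "x < t"
    then have "t \<in> {y \<in> N n. y \<le> t}" "t \<notin> {y \<in> N n. y \<le> x}"
        "{y \<in> N n. y \<le> x} \<subseteq> {y \<in> N n. y \<le> t}"
      using that by auto
    then have "card {y \<in> N n. y \<le> x} < card {y \<in> N n. y \<le> t}"
      using N(1)[of n] by (intro psubset_card_mono) auto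
    with that show False
      by simp
  qed
  from this[of x t] this[of t x] have "x = t"
    using x tn card_t by simp
  with k_le show ?case
    by (simp add: x_def)
qed

text \<open>If the kth element were below \<open>M\<close> while \<open>N n\<close> and
  \<open>S\<close> agree up to \<open>M\<close>, then \<open>S\<close> would contain
  \<open>k\<close> elements.\<close>

lemma kth_element_at_top:
  assumes "finite S" "card S < k" and k: "\<forall>\<^sub>F n in sequentially. k \<le> card (N n)"
  shows "filterlim (\<lambda>n. sorted_list_of_set (N n) ! (k - 1)) at_top sequentially"
  unfolding filterlim_at_top
proof
  fix M
  show "\<forall>\<^sub>F n in sequentially. M \<le> sorted_list_of_set (N n) ! (k - 1)"
    using k initial_iff[of M]
  proof eventually_elim
    case (elim n)
    let ?x = "sorted_list_of_set (N n) ! (k - 1)"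
    have "card {y \<in> N n. y \<le> ?x} = k"
      using assms(2) elim(1) by (intro nth_sorted_list_of_set_props N) auto
    moreover have "card {y \<in> N n. y \<le> ?x} \<le> card S" if "?x < M"
    proof (rule card_mono[OF assms(1)])
      show "{y \<in> N n. y \<le> ?x} \<subseteq> S"
        using elim(2) that by auto
    qed
    ultimately show ?case
      using assms(2) by linarith
  qed
qed

end

section \<open>The mixed order\<close>

lemma pred_order_word:
  "Measurable.pred orders_borel (\<lambda>R. P (order_word n R))"
  by (rule measurable_compose[OF measurable_order_word]) simp

lemma pred_nonrecords [measurable]:
  "Measurable.pred orders_borel
    (\<lambda>R. \<forall>M. \<forall>\<^sub>F n in sequentially. nonrecords n (order_word n R) \<inter> {1..M} = S \<inter> {1..M})"
proof -
  have [measurable]: "Measurable.pred orders_borel (\<lambda>R. nonrecords n (order_word n R) \<inter> T = U)" for n T U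
    by (rule pred_order_word)
  show ?thesis
    by measurable
qed

definition nonrecord_positions :: "enat \<Rightarrow> (nat \<Rightarrow> nat) \<Rightarrow> nat set" where
  "nonrecord_positions len a = (\<lambda>k. a k + 1) ` seq_indices len"

text \<open>For \<open>i \<in> S\<close> the rank is uniform on \<open>{1..i - 1}\<close>, so it is
  at most \<open>m\<close> with probability at most m / (i - 1). \<open>AE_card_le_sublinear\<close>
  turns this into the sparsity demanded by \<open>relative_ranks\<close>.\<close>

lemma AE_relrank_law:
  assumes mono: "strict_mono_on (seq_indices len) a"
    and pos: "\<forall>k\<in>seq_indices len. 0 < a k"
    and summable: "(\<lambda>k. 1 / real (a k)) summable_on seq_indices len"
  defines "S \<equiv> nonrecord_positions len a"
  shows "AE r in relrank_law len a. relative_ranks r \<and> (\<forall>i\<ge>1. r i < i \<longleftrightarrow> i \<in> S)"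
proof -
  define q where "q i = (if i \<in> S then pmf_of_set {1..i - 1} else return_pmf i)" for i
  have law: "relrank_law len a = (\<Pi>\<^sub>M i\<in>{1..}. measure_pmf (q i))"
    unfolding relrank_law_def q_def S_def nonrecord_positions_def ..
  let ?M = "\<Pi>\<^sub>M i\<in>{1..}. measure_pmf (q i)"
  have q: "prob_space (measure_pmf (q i))" for i
    by (rule measure_pmf.prob_space_axioms)
  interpret prob_space ?M
    by (intro prob_space_PiM q)
  \<comment> \<open>Positivity of \<open>a\<close> makes \<open>{1..i - 1}\<close> nonempty, so that
    \<open>pmf_of_set\<close> is really the uniform law.\<close>
  have S_ge: "2 \<le> i" if "i \<in> S" for i
    using that pos by (force simp: S_def nonrecord_positions_def)
  then have S_sub: "S \<subseteq> {1..}"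
    by fastforce
  have set_q: "set_pmf (q i) = {1..i - 1}" if "i \<in> S" for i
    using that S_ge[OF that] by (simp add: q_def set_pmf_of_set)

  have "AE r in ?M. \<forall>i. 1 \<le> i \<longrightarrow> r i \<in> set_pmf (q i)"
  proof (subst AE_all_countable, rule allI)
    fix i
    show "AE r in ?M. 1 \<le> i \<longrightarrow> r i \<in> set_pmf (q i)"
    proof (cases "1 \<le> i")
      case True
      then have "AE r in ?M. r i \<in> set_pmf (q i)"
        by (intro AE_PiM_component q) (auto simp: AE_measure_pmf)
      then show ?thesis
        by eventually_elim simp
    qed simp
  qed
  moreover have "AE r in ?M. \<forall>t. \<forall>\<^sub>F m in sequentially.
      finite {i \<in> S. r i \<le> m} \<and> real (Suc t) * card {i \<in> S. r i \<le> m} \<le> real m"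
  \<comment> \<open>For \<open>i = a k + 1\<close> the weight is \<open>1 / real (a k)\<close>, so
    reindexing reduces its summability to the hypothesis.\<close>
  proof (rule AE_card_le_sublinear[where f = "\<lambda>i. 1 / real (i - 1)"])
    have "indep_vars (\<lambda>i. measure_pmf (q i)) (\<lambda>i r. r i) S"
      by (rule indep_vars_subset[OF indep_vars_PiM_component S_sub]) (auto intro: q)
    then show "indep_vars (\<lambda>_. count_space UNIV) (\<lambda>i r. r i) S"
      by (rule indep_vars_compose2) simp
    have "inj_on a (seq_indices len)"
      using mono by (rule strict_mono_on_imp_inj_on)
    then have inj: "inj_on (\<lambda>k. a k + 1) (seq_indices len)"
      by (simp add: inj_on_def)
    show "(\<lambda>i. 1 / real (i - 1)) summable_on S"
      unfolding S_def nonrecord_positions_def summable_on_reindex[OF inj] o_def diff_add_inverse2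
      by (rule summable)
    fix i m
    assume i: "i \<in> S"
    have "prob {r \<in> space ?M. r i \<le> m} = measure (distr ?M (measure_pmf (q i)) (\<lambda>r. r i)) {..m}"
    proof (subst measure_distr)
      show "(\<lambda>r. r i) \<in> measurable ?M (measure_pmf (q i))"
        using i S_sub by (intro measurable_component_singleton) auto
      have "{r \<in> space ?M. r i \<le> m} = (\<lambda>r. r i) -` {..m} \<inter> space ?M"
        by blast
      then show "prob {r \<in> space ?M. r i \<le> m} = prob ((\<lambda>r. r i) -` {..m} \<inter> space ?M)"
        by (rule arg_cong)
    qed simp
    also have "distr ?M (measure_pmf (q i)) (\<lambda>r. r i) = measure_pmf (q i)"
      using i S_sub by (intro distr_PiM_component q) auto
    also have "measure (measure_pmf (q i)) {..m} = card ({1..i - 1} \<inter> {..m}) / real (i - 1)"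
      using i S_ge[OF i] by (simp add: q_def measure_pmf_of_set)
    also have "\<dots> \<le> real m / real (i - 1)"
    proof (intro divide_right_mono)
      have "card ({1..i - 1} \<inter> {..m}) \<le> card {1..m}"
        by (intro card_mono) auto
      then show "real (card ({1..i - 1} \<inter> {..m})) \<le> real m"
        by simp
    qed simp
    finally show "prob {r \<in> space ?M. r i \<le> m} \<le> real m * (1 / real (i - 1))"
      by simp
  qed simp
  ultimately show ?thesis
    unfolding law
  proof eventually_elim
    fix r
    assume r: "\<forall>i. 1 \<le> i \<longrightarrow> r i \<in> set_pmf (q i)"
      and sparse: "\<forall>t. \<forall>\<^sub>F m in sequentially.
        finite {i \<in> S. r i \<le> m} \<and> real (Suc t) * card {i \<in> S. r i \<le> m} \<le> real m"
    have off: "r i = i" if "1 \<le> i" "i \<notin> S" for i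
      using r that by (auto simp: q_def)
    have on: "1 \<le> r i \<and> r i < i" if "i \<in> S" for i
      using r[rule_format, of i] S_ge[OF that] set_q[OF that] by auto
    have iff: "\<forall>i\<ge>1. r i < i \<longleftrightarrow> i \<in> S"
      using off on by (metis less_irrefl)
    have "relative_ranks r"
    proof
      show "1 \<le> r i \<and> r i \<le> i" if "1 \<le> i" for i
        using off[OF that] on[of i] that by (cases "i \<in> S") auto
    next
      fix t
      have eq: "{i \<in> {1..}. r i < i \<and> r i \<le> m} = {i \<in> S. r i \<le> m}" for m
        using iff S_sub by auto
      show "\<forall>\<^sub>F m in sequentially. finite {i \<in> {1..}. r i < i \<and> r i \<le> m} \<and>
          Suc t * card {i \<in> {1..}. r i < i \<and> r i \<le> m} \<le> m"
        unfolding eq using sparse[rule_format, of t]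
        by eventually_elim (simp only: of_nat_le_iff flip: of_nat_mult)
    qed
    with iff show "relative_ranks r \<and> (\<forall>i\<ge>1. r i < i \<longleftrightarrow> i \<in> S)"
      by blast
  qed
qed

text \<open>\<open>AE_distrI\<close> asks for a measurable event, so both limit properties are
  phrased through the words alone: \<open>rank_in\<close> becomes the inverse of the word.\<close>

lemma AE_nonrecord_order:
  assumes "strict_mono_on (seq_indices len) a"
    and "\<forall>k\<in>seq_indices len. 0 < a k"
    and "(\<lambda>k. 1 / real (a k)) summable_on seq_indices len"
  defines "S \<equiv> nonrecord_positions len a"
  shows "AE R in nonrecord_order len a. R \<in> orders \<and>
    (\<forall>M. \<forall>\<^sub>F m in sequentially. nonrecords m (order_word m R) \<inter> {1..M} = S \<inter> {1..M}) \<and>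
    (\<forall>q. \<forall>\<^sub>F m in sequentially. Suc q * m \<le> Suc q * inv (order_word m R) m + m)"
proof -
  let ?P = "\<lambda>R. (\<forall>M. \<forall>\<^sub>F m in sequentially. nonrecords m (order_word m R) \<inter> {1..M} = S \<inter> {1..M}) \<and>
    (\<forall>q. \<forall>\<^sub>F m in sequentially. Suc q * m \<le> Suc q * inv (order_word m R) m + m)"
  have "AE R in nonrecord_order len a. ?P R"
    unfolding nonrecord_order_def
  proof (rule AE_distrI)
    have [measurable]: "Measurable.pred orders_borel (\<lambda>R. Suc q * m \<le> Suc q * inv (order_word m R) m + m)" for q m
      by (rule pred_order_word)
    show "{R \<in> space orders_borel. ?P R} \<in> sets orders_borel"
      by measurable
    show "AE r in relrank_law len a. order_of_ranks r \<in> space orders_borel \<longrightarrow> ?P (order_of_ranks r)"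
      using AE_relrank_law[OF assms(1-3)]
    proof eventually_elim
      case (elim r)
      then interpret relative_ranks r
        by simp
      have S: "{l \<in> {1..M}. r l < l} = S \<inter> {1..M}" for M
        using elim by (auto simp: S_def)
      have "\<forall>\<^sub>F m in sequentially. Suc q * m \<le> Suc q * inv (order_word m (order_of_ranks r)) m + m" for q
        using max_letter_near_end[of q] eventually_ge_at_top[of 1]
      proof eventually_elim
        case (elim m)
        then show ?case
          using inv_order_word[OF order_of_ranks_in_orders, of m m] by simp
      qed
      then show ?case
        using initial_nonrecords by (simp only: S) blast
    qed
  qed
  moreover have "AE R in nonrecord_order len a. R \<in> orders"
    using AE_space[of "nonrecord_order len a"] by (simp add: nonrecord_order_def)
  ultimately show ?thesis
    by eventually_elim blast
qed

text \<open>Supplies the count that \<open>eventually_kth_element\<close> needs to recognise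
  \<open>a k + 1\<close> as the kth element.\<close>

lemma card_nonrecord_positions_le:
  assumes mono: "strict_mono_on (seq_indices len) a" and k: "k \<in> seq_indices len"
  shows "card {y \<in> nonrecord_positions len a. y \<le> a k + 1} = k"
proof -
  have sub: "{1..k} \<subseteq> seq_indices len"
    using k by (auto simp: seq_indices_def intro: order.trans[of _ "enat k"])
  have iff: "a l \<le> a k \<longleftrightarrow> l \<le> k" if "l \<in> seq_indices len" for l
    using strict_mono_onD[OF mono that k] strict_mono_onD[OF mono k that]
    by (cases l k rule: linorder_cases) auto
  have "{l \<in> seq_indices len. l \<le> k} = {1..k}"
    using sub by (auto simp: seq_indices_def)
  moreover have "{y \<in> nonrecord_positions len a. y \<le> a k + 1} = (\<lambda>l. a l + 1) ` {l \<in> seq_indices len. l \<le> k}"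
    using iff by (auto simp: nonrecord_positions_def)
  moreover have "card ((\<lambda>l. a l + 1) ` {1..k}) = card {1..k}"
    using inj_on_subset[OF strict_mono_on_imp_inj_on[OF mono] sub]
    by (intro card_image inj_onI) (auto dest: inj_onD)
  ultimately show ?thesis
    by simp
qed

lemma finite_nonrecord_positions:
  assumes "k \<notin> seq_indices len" "1 \<le> k"
  shows "finite (nonrecord_positions len a)" "card (nonrecord_positions len a) < k"
proof -
  have sub: "seq_indices len \<subseteq> {1..<k}"
  proof
    fix l
    assume "l \<in> seq_indices len"
    then have "1 \<le> l" "enat l \<le> len"
      by (auto simp: seq_indices_def)
    moreover have "len < enat k"
      using assms by (auto simp: seq_indices_def)
    ultimately show "l \<in> {1..<k}"
      by (metis atLeastLessThan_iff enat_ord_simps(2) order.strict_trans1)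
  qed
  then have fin: "finite (seq_indices len)"
    by (rule finite_subset) simp
  then show "finite (nonrecord_positions len a)"
    by (simp add: nonrecord_positions_def)
  have "card (nonrecord_positions len a) \<le> card (seq_indices len)"
    unfolding nonrecord_positions_def using fin by (rule card_image_le)
  also have "\<dots> \<le> card {1..<k}"
    using sub by (intro card_mono) auto
  finally show "card (nonrecord_positions len a) < k"
    using assms(2) by simp
qed

theorem proposition3p5:
  fixes len :: enat and a :: "nat \<Rightarrow> nat" and p :: real
  assumes "strict_mono_on (seq_indices len) a"
    and "\<forall>k\<in>seq_indices len. 0 < a k"
    and "(\<lambda>k. 1 / real (a k)) summable_on seq_indices len"
    and "0 < p" and "p \<le> 1"
  shows "AE R in mixed_order len a p.
    (\<forall>k\<ge>1.
      (k \<in> seq_indices len \<longrightarrow>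
         (\<forall>\<^sub>F n in sequentially. k \<le> card (nonrecords n (order_word n R))) \<and>
         (\<lambda>n. kth_nonrecord n (order_word n R) k) \<longlonglongrightarrow> a k + 1) \<and>
      (k \<notin> seq_indices len \<longrightarrow>
         (\<forall>\<^sub>F n in sequentially. k \<le> card (nonrecords n (order_word n R))) \<longrightarrow>
         filterlim (\<lambda>n. kth_nonrecord n (order_word n R) k) at_top sequentially)) \<and>
    liminf (\<lambda>n. ereal (real (inv (order_word n R) n) / real n)) = ereal p"
proof -
  let ?S = "nonrecord_positions len a"
  let ?B = "\<Pi>\<^sub>M i\<in>{1::nat..}. measure_pmf (bernoulli_pmf p)"
  \<comment> \<open>Agreement with \<open>?S\<close> on initial segments replaces the claim about
    the kth positions: it is a countable combination of events on single words, and the claim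
    follows from it for each order separately.\<close>
  let ?Q = "\<lambda>R. (\<forall>M. \<forall>\<^sub>F n in sequentially. nonrecords n (order_word n R) \<inter> {1..M} = ?S \<inter> {1..M}) \<and>
    liminf (\<lambda>n. ereal (real (inv (order_word n R) n) / real n)) = ereal p"
  have "AE R in mixed_order len a p. ?Q R"
    unfolding mixed_order_def
  proof (rule AE_distrI)
    have [measurable]: "(\<lambda>R. ereal (real (inv (order_word n R) n) / real n)) \<in> borel_measurable orders_borel" for n
      by (rule measurable_compose[OF measurable_order_word]) simp
    show "{R \<in> space orders_borel. ?Q R} \<in> sets orders_borel"
      by measurable
    have "AE b in ?B. (\<lambda>n. card {i \<in> {1..n}. b i} / real n) \<longlonglongrightarrow> p"
      using assms(4,5) by (intro bernoulli_frequency) auto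
    \<comment> \<open>The density concerns \<open>b\<close> and the word estimates concern
      \<open>R1\<close>; the lemmas on pairs lift both to the triple product.\<close>
    note AE_pair_fst[OF this, of "nonrecord_order len a \<Otimes>\<^sub>M uniform_order"]
      AE_pair_snd[OF AE_pair_fst[OF AE_nonrecord_order[OF assms(1-3)], of uniform_order], of ?B]
    then show "AE x in ?B \<Otimes>\<^sub>M (nonrecord_order len a \<Otimes>\<^sub>M uniform_order).
      (case x of (b, R1, R2) \<Rightarrow> concat_order {i \<in> {1..}. b i} R1 R2) \<in> space orders_borel \<longrightarrow>
      ?Q (case x of (b, R1, R2) \<Rightarrow> concat_order {i \<in> {1..}. b i} R1 R2)"
    proof eventually_elim
      case (elim x)
      obtain b R1 R2 where x: "x = (b, R1, R2)"
        by (cases x) auto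
      let ?N = "{i \<in> {1..}. b i}"
      have "count_upto ?N n = card {i \<in> {1..n}. b i}" for n
        unfolding count_upto_def by (rule arg_cong[where f = card]) auto
      then have density: "(\<lambda>n. count_upto ?N n / real n) \<longlonglongrightarrow> p"
        using elim(1) by (simp add: x)
      show ?case
      proof
        \<comment> \<open>This premise, provided by \<open>AE_distrI\<close>, is what makes the
          concatenation a total order.\<close>
        assume "(case x of (b, R1, R2) \<Rightarrow> concat_order {i \<in> {1..}. b i} R1 R2) \<in> space orders_borel"
        then have "concat_order ?N R1 R2 \<in> orders"
          by (simp add: x)
        from concat_order_limits[OF _ _ this density assms(4), of ?S] elim(2)
        show "?Q (case x of (b, R1, R2) \<Rightarrow> concat_order {i \<in> {1..}. b i} R1 R2)"
          unfolding x by auto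
      qed
    qed
  qed
  then show ?thesis
  proof eventually_elim
    case (elim R)
    let ?N = "\<lambda>n. nonrecords n (order_word n R)"
    have N: "finite (?N n)" "?N n \<subseteq> {1..}" for n
      by (auto simp: nonrecords_def)
    have S: "?S \<subseteq> {1..}"
      by (auto simp: nonrecord_positions_def)
    have init: "\<forall>\<^sub>F n in sequentially. ?N n \<inter> {1..M} = ?S \<inter> {1..M}" for M
      using elim by blast
    have "(\<forall>\<^sub>F n in sequentially. k \<le> card (?N n)) \<and>
        (\<lambda>n. kth_nonrecord n (order_word n R) k) \<longlonglongrightarrow> a k + 1" if k: "k \<in> seq_indices len" for k
    proof -
      have "a k + 1 \<in> ?S"
        using k by (auto simp: nonrecord_positions_def)
      from eventually_kth_element[OF N S init this card_nonrecord_positions_le[OF assms(1) k]]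
      have "\<forall>\<^sub>F n in sequentially. k \<le> card (?N n)"
        "\<forall>\<^sub>F n in sequentially. kth_nonrecord n (order_word n R) k = a k + 1"
        by (auto simp: kth_nonrecord_def elim: eventually_mono)
      then show ?thesis
        by (auto intro: tendsto_eventually)
    qed
    moreover have "filterlim (\<lambda>n. kth_nonrecord n (order_word n R) k) at_top sequentially"
      if "1 \<le> k" "k \<notin> seq_indices len" "\<forall>\<^sub>F n in sequentially. k \<le> card (?N n)" for k
      unfolding kth_nonrecord_def
      using kth_element_at_top[OF N S init finite_nonrecord_positions[OF that(2,1)] that(3)] .
    ultimately show ?case
      using elim by blast
  qed
qed

end
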